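(* Let $\mathcal{A},\mathcal{B}$ be abelian categories and let $\mathcal{U}:\mathcal{A}\to\mathcal{B}$ be an additive, exact and faithful functor with left adjoint $\mathcal{F}:\mathcal{B}\to\mathcal{A}$ (a resolvent pair). Let $G=\mathcal{F}\mathcal{U}$ be the associated comonad on $\mathcal{A}$. Then: 1. An object $P\in\mathcal{A}$ is $G$-projective if and only if it is relatively projective. 2. A sequence $0\leftarrow V\leftarrow P_0\leftarrow P_1\leftarrow\cdots$ in $\mathcal{A}$ is a $G$-resolution if and only if it is a relatively projective resolution. 3. For any $V,W\in\mathcal{A}$ there is an equality of complexes $\mathrm{Bar}^\bullet_G\bigl(V,\mathrm{Hom}_{\mathcal{A}}(?,W)\bigr)=\mathrm{Bar}^\bullet_{\mathcal{A},\mathcal{B}}(V,W)$. 4. Consequently, $\mathrm{Ext}^n_{\mathcal{A},\mathcal{B}}(V,W)\cong H^n_G\bigl(V,\mathrm{Hom}_{\mathcal{A}}(?,W)\bigr)$ for all $V,W\in\mathcal{A}$ and $n\ge0$.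
   Context: Let $\varepsilon:G=\mathcal{F}\mathcal{U}\to\mathrm{Id}_{\mathcal{A}}$ be the counit of the adjunction. Relative homological algebra. A morphism $f:V\to W$ in $\mathcal{A}$ is allowable if there is $s\in\mathrm{Hom}_{\mathcal{B}}(\mathcal{U}(W),\mathcal{U}(V))$ with $\mathcal{U}(f)s\,\mathcal{U}(f)=\mathcal{U}(f)$. An object $P$ is relatively projective if every morphism $P\to W$ lifts along every allowable epimorphism $V\to W$. A relatively projective resolution of $V$ is an exact sequence $0\leftarrow V\xleftarrow{d_0}P_0\xleftarrow{d_1}P_1\leftarrow\cdots$ with all $P_i$ relatively projective and all $d_i$ allowable. $\mathrm{Ext}^n_{\mathcal{A},\mathcal{B}}(V,W)$ is the $n$-th cohomology of $0\to\mathrm{Hom}_{\mathcal{A}}(P_0,W)\to\mathrm{Hom}_{\mathcal{A}}(P_1,W)\to\cdots$, independent of the resolution. The bar resolution of $V$ is the relatively projective resolution with terms $P_n=(\mathcal{F}\mathcal{U})^{n+1}(V)$, $d_0=\varepsilon_V$, $d_n=\sum_{i=0}^n(-1)^i(\mathcal{F}\mathcal{U})^{n-i}(\varepsilon_{(\mathcal{F}\mathcal{U})^i(V)})$; applying $\mathrm{Hom}_{\mathcal{A}}(-,W)$ to it gives the complex $\mathrm{Bar}^\bullet_{\mathcal{A},\mathcal{B}}(V,W)$. Comonad cohomology. $P\in\mathcal{A}$ is $G$-projective if there is $s:P\to G(P)$ with $\varepsilon_Ps=\mathrm{id}_P$ (equivalently, $P$ is a direct summand of some $G(V)$). A sequence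 $X\xrightarrow{f}Y\xrightarrow{g}Z$ is $G$-exact if $gf=0$ and $\mathrm{Hom}_{\mathcal{A}}(G(V),X)\to\mathrm{Hom}_{\mathcal{A}}(G(V),Y)\to\mathrm{Hom}_{\mathcal{A}}(G(V),Z)$ is exact for all $V\in\mathcal{A}$. A $G$-resolution of $V$ is a $G$-exact sequence $0\leftarrow V\leftarrow P_0\leftarrow P_1\leftarrow\cdots$ with all $P_i$ $G$-projective. For a contravariant additive functor $E$ from $\mathcal{A}$ to an abelian category, $H^n_G(V,E)$ is the $n$-th cohomology of $0\to E(P_0)\to E(P_1)\to\cdots$ for any $G$-resolution of $V$. The $G$-bar resolution has terms $G^{n+1}(V)$ and differentials $d_n=\sum_{i=0}^n(-1)^iG^{n-i}(\varepsilon_{G^i(V)})$; applying $E$ to it gives $\mathrm{Bar}^\bullet_G(V,E)$. *)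

theory Defs
  imports "HOL-Algebra.Exact_Sequence" "HOL-Algebra.FiniteProduct"
begin

section \<open>Abelian categories\<close>

text \<open>
  Categories are carrier-based: hom-sets are pairwise disjoint, since every arrow determines its
  domain and codomain. \<open>AddArr\<close> and \<open>ZeroArr\<close> carry the group structure of the hom-sets and are
  meaningful for parallel arrows (resp. for objects) only. The arrow \<open>g \<cdot> f\<close> is ``g after f''.
\<close>

record ('o, 'm) cat =
  Obj :: "'o set"
  Arr :: "'m set"
  Dom :: "'m \<Rightarrow> 'o"
  Cod :: "'m \<Rightarrow> 'o"
  Ident :: "'o \<Rightarrow> 'm"
  Comp :: "'m \<Rightarrow> 'm \<Rightarrow> 'm"  (infixr "\<cdot>\<index>" 75)
  AddArr :: "'m \<Rightarrow> 'm \<Rightarrow> 'm"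
  ZeroArr :: "'o \<Rightarrow> 'o \<Rightarrow> 'm"

definition homset :: "('o, 'm) cat \<Rightarrow> 'o \<Rightarrow> 'o \<Rightarrow> 'm set" where
  "homset C X Y = {f \<in> Arr C. Dom C f = X \<and> Cod C f = Y}"

text \<open>Abelian groups are written multiplicatively, as everywhere in HOL-Algebra's group theory.\<close>

definition homgrp :: "('o, 'm) cat \<Rightarrow> 'o \<Rightarrow> 'o \<Rightarrow> 'm monoid" where
  "homgrp C X Y = \<lparr>carrier = homset C X Y, mult = AddArr C, one = ZeroArr C X Y\<rparr>"

locale category =
  fixes C :: "('o, 'm) cat" (structure)
  assumes Dom_Obj: "f \<in> Arr C \<Longrightarrow> Dom C f \<in> Obj C"
    and Cod_Obj: "f \<in> Arr C \<Longrightarrow> Cod C f \<in> Obj C"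
    and Ident_homset: "X \<in> Obj C \<Longrightarrow> Ident C X \<in> homset C X X"
    and Comp_homset: "\<lbrakk>g \<in> homset C Y Z; f \<in> homset C X Y\<rbrakk> \<Longrightarrow> g \<cdot> f \<in> homset C X Z"
    and Comp_Ident: "f \<in> homset C X Y \<Longrightarrow> f \<cdot> Ident C X = f"
    and Ident_Comp: "f \<in> homset C X Y \<Longrightarrow> Ident C Y \<cdot> f = f"
    and Comp_assoc: "\<lbrakk>h \<in> homset C Y Z; g \<in> homset C X Y; f \<in> homset C W X\<rbrakk>
      \<Longrightarrow> (h \<cdot> g) \<cdot> f = h \<cdot> (g \<cdot> f)"

locale preadditive_category = category +
  assumes homgrp_comm_group: "\<lbrakk>X \<in> Obj C; Y \<in> Obj C\<rbrakk> \<Longrightarrow> comm_group (homgrp C X Y)"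
    and Comp_AddArr: "\<lbrakk>h \<in> homset C Y Z; f \<in> homset C X Y; g \<in> homset C X Y\<rbrakk>
      \<Longrightarrow> h \<cdot> AddArr C f g = AddArr C (h \<cdot> f) (h \<cdot> g)"
    and AddArr_Comp: "\<lbrakk>f \<in> homset C Y Z; g \<in> homset C Y Z; h \<in> homset C X Y\<rbrakk>
      \<Longrightarrow> AddArr C f g \<cdot> h = AddArr C (f \<cdot> h) (g \<cdot> h)"

definition is_zero_object :: "('o, 'm) cat \<Rightarrow> 'o \<Rightarrow> bool" where
  "is_zero_object C Z \<longleftrightarrow> Z \<in> Obj C \<and>
     (\<forall>X\<in>Obj C. (\<exists>!f. f \<in> homset C X Z) \<and> (\<exists>!f. f \<in> homset C Z X))"

definition is_biproduct ::
    "('o, 'm) cat \<Rightarrow> 'o \<Rightarrow> 'o \<Rightarrow> 'o \<Rightarrow> 'm \<Rightarrow> 'm \<Rightarrow> 'm \<Rightarrow> 'm \<Rightarrow> bool" where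
  "is_biproduct C X Y S i j p q \<longleftrightarrow>
     i \<in> homset C X S \<and> j \<in> homset C Y S \<and> p \<in> homset C S X \<and> q \<in> homset C S Y \<and>
     p \<cdot>\<^bsub>C\<^esub> i = Ident C X \<and> q \<cdot>\<^bsub>C\<^esub> j = Ident C Y \<and>
     p \<cdot>\<^bsub>C\<^esub> j = ZeroArr C Y X \<and> q \<cdot>\<^bsub>C\<^esub> i = ZeroArr C X Y \<and>
     AddArr C (i \<cdot>\<^bsub>C\<^esub> p) (j \<cdot>\<^bsub>C\<^esub> q) = Ident C S"

definition is_mono :: "('o, 'm) cat \<Rightarrow> 'm \<Rightarrow> bool" where
  "is_mono C f \<longleftrightarrow> f \<in> Arr C \<and>
     (\<forall>X. \<forall>g\<in>homset C X (Dom C f). \<forall>h\<in>homset C X (Dom C f). f \<cdot>\<^bsub>C\<^esub> g = f \<cdot>\<^bsub>C\<^esub> h \<longrightarrow> g = h)"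

definition is_epi :: "('o, 'm) cat \<Rightarrow> 'm \<Rightarrow> bool" where
  "is_epi C f \<longleftrightarrow> f \<in> Arr C \<and>
     (\<forall>Y. \<forall>g\<in>homset C (Cod C f) Y. \<forall>h\<in>homset C (Cod C f) Y. g \<cdot>\<^bsub>C\<^esub> f = h \<cdot>\<^bsub>C\<^esub> f \<longrightarrow> g = h)"

definition is_kernel :: "('o, 'm) cat \<Rightarrow> 'm \<Rightarrow> 'm \<Rightarrow> bool" where
  "is_kernel C k f \<longleftrightarrow> k \<in> Arr C \<and> f \<in> Arr C \<and> Cod C k = Dom C f \<and>
     f \<cdot>\<^bsub>C\<^esub> k = ZeroArr C (Dom C k) (Cod C f) \<and>
     (\<forall>T. \<forall>t\<in>homset C T (Dom C f). f \<cdot>\<^bsub>C\<^esub> t = ZeroArr C T (Cod C f) \<longrightarrow>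
        (\<exists>!u. u \<in> homset C T (Dom C k) \<and> k \<cdot>\<^bsub>C\<^esub> u = t))"

definition is_cokernel :: "('o, 'm) cat \<Rightarrow> 'm \<Rightarrow> 'm \<Rightarrow> bool" where
  "is_cokernel C c f \<longleftrightarrow> c \<in> Arr C \<and> f \<in> Arr C \<and> Dom C c = Cod C f \<and>
     c \<cdot>\<^bsub>C\<^esub> f = ZeroArr C (Dom C f) (Cod C c) \<and>
     (\<forall>T. \<forall>t\<in>homset C (Cod C f) T. t \<cdot>\<^bsub>C\<^esub> f = ZeroArr C (Dom C f) T \<longrightarrow>
        (\<exists>!u. u \<in> homset C (Cod C c) T \<and> u \<cdot>\<^bsub>C\<^esub> c = t))"

locale abelian_category = preadditive_category +
  assumes ex_zero_object: "\<exists>Z. is_zero_object C Z"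
    and ex_biproduct: "\<lbrakk>X \<in> Obj C; Y \<in> Obj C\<rbrakk> \<Longrightarrow> \<exists>S i j p q. is_biproduct C X Y S i j p q"
    and ex_kernel: "f \<in> Arr C \<Longrightarrow> \<exists>k. is_kernel C k f"
    and ex_cokernel: "f \<in> Arr C \<Longrightarrow> \<exists>c. is_cokernel C c f"
    and mono_is_kernel: "is_mono C f \<Longrightarrow> \<exists>g. is_kernel C f g"
    and epi_is_cokernel: "is_epi C f \<Longrightarrow> \<exists>g. is_cokernel C f g"

text \<open>The image of \<open>f\<close> is the kernel of its cokernel. Kernels being unique up to isomorphism,
  \<open>im f = ker g\<close> as subobjects says that some arrow represents both.\<close>

definition is_image :: "('o, 'm) cat \<Rightarrow> 'm \<Rightarrow> 'm \<Rightarrow> bool" where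
  "is_image C m f \<longleftrightarrow> (\<exists>c. is_cokernel C c f \<and> is_kernel C m c)"

definition exact_pair :: "('o, 'm) cat \<Rightarrow> 'm \<Rightarrow> 'm \<Rightarrow> bool" where
  "exact_pair C f g \<longleftrightarrow> f \<in> Arr C \<and> g \<in> Arr C \<and> Cod C f = Dom C g \<and>
     (\<exists>m. is_image C m f \<and> is_kernel C m g)"

definition short_exact :: "('o, 'm) cat \<Rightarrow> 'm \<Rightarrow> 'm \<Rightarrow> bool" where
  "short_exact C f g \<longleftrightarrow> (\<exists>Z. is_zero_object C Z \<and>
     exact_pair C (ZeroArr C Z (Dom C f)) f \<and> exact_pair C f g \<and>
     exact_pair C g (ZeroArr C (Cod C g) Z))"


section \<open>Functors, adjunctions and comonads\<close>

record ('o, 'm, 'p, 'q) cat_functor =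
  omap :: "'o \<Rightarrow> 'p"
  amap :: "'m \<Rightarrow> 'q"

definition comp_functor ::
    "('p, 'q, 'r, 's) cat_functor \<Rightarrow> ('o, 'm, 'p, 'q) cat_functor \<Rightarrow> ('o, 'm, 'r, 's) cat_functor" where
  "comp_functor S T = \<lparr>omap = omap S \<circ> omap T, amap = amap S \<circ> amap T\<rparr>"

definition id_functor :: "('o, 'm, 'o, 'm) cat_functor" where
  "id_functor = \<lparr>omap = id, amap = id\<rparr>"

definition is_functor ::
    "('o, 'm) cat \<Rightarrow> ('p, 'q) cat \<Rightarrow> ('o, 'm, 'p, 'q) cat_functor \<Rightarrow> bool" where
  "is_functor C D T \<longleftrightarrow>
     (\<forall>X\<in>Obj C. omap T X \<in> Obj D) \<and>
     (\<forall>X Y. \<forall>f\<in>homset C X Y. amap T f \<in> homset D (omap T X) (omap T Y)) \<and>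
     (\<forall>X\<in>Obj C. amap T (Ident C X) = Ident D (omap T X)) \<and>
     (\<forall>X Y Z. \<forall>g\<in>homset C Y Z. \<forall>f\<in>homset C X Y.
        amap T (g \<cdot>\<^bsub>C\<^esub> f) = amap T g \<cdot>\<^bsub>D\<^esub> amap T f)"

definition is_additive_functor ::
    "('o, 'm) cat \<Rightarrow> ('p, 'q) cat \<Rightarrow> ('o, 'm, 'p, 'q) cat_functor \<Rightarrow> bool" where
  "is_additive_functor C D T \<longleftrightarrow> is_functor C D T \<and>
     (\<forall>X\<in>Obj C. \<forall>Y\<in>Obj C.
        amap T \<in> hom (homgrp C X Y) (homgrp D (omap T X) (omap T Y)))"

definition is_exact_functor ::
    "('o, 'm) cat \<Rightarrow> ('p, 'q) cat \<Rightarrow> ('o, 'm, 'p, 'q) cat_functor \<Rightarrow> bool" where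
  "is_exact_functor C D T \<longleftrightarrow> is_functor C D T \<and>
     (\<forall>f g. short_exact C f g \<longrightarrow> short_exact D (amap T f) (amap T g))"

definition is_faithful_functor ::
    "('o, 'm) cat \<Rightarrow> ('p, 'q) cat \<Rightarrow> ('o, 'm, 'p, 'q) cat_functor \<Rightarrow> bool" where
  "is_faithful_functor C D T \<longleftrightarrow> is_functor C D T \<and>
     (\<forall>X\<in>Obj C. \<forall>Y\<in>Obj C. inj_on (amap T) (homset C X Y))"

definition is_natural ::
    "('o, 'm) cat \<Rightarrow> ('p, 'q) cat \<Rightarrow> ('o, 'm, 'p, 'q) cat_functor \<Rightarrow> ('o, 'm, 'p, 'q) cat_functor
       \<Rightarrow> ('o \<Rightarrow> 'q) \<Rightarrow> bool" where
  "is_natural C D S T \<tau> \<longleftrightarrow>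
     (\<forall>X\<in>Obj C. \<tau> X \<in> homset D (omap S X) (omap T X)) \<and>
     (\<forall>X Y. \<forall>f\<in>homset C X Y. \<tau> Y \<cdot>\<^bsub>D\<^esub> amap S f = amap T f \<cdot>\<^bsub>D\<^esub> \<tau> X)"

text \<open>\<open>F : B \<rightarrow> A\<close> is left adjoint to \<open>U : A \<rightarrow> B\<close> with unit \<open>\<eta>\<close> and counit \<open>\<epsilon>\<close>.\<close>

definition is_adjunction ::
    "('o, 'm) cat \<Rightarrow> ('p, 'q) cat \<Rightarrow> ('p, 'q, 'o, 'm) cat_functor \<Rightarrow> ('o, 'm, 'p, 'q) cat_functor
       \<Rightarrow> ('p \<Rightarrow> 'q) \<Rightarrow> ('o \<Rightarrow> 'm) \<Rightarrow> bool" where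
  "is_adjunction A B F U \<eta> \<epsilon> \<longleftrightarrow>
     is_functor B A F \<and> is_functor A B U \<and>
     is_natural B B id_functor (comp_functor U F) \<eta> \<and>
     is_natural A A (comp_functor F U) id_functor \<epsilon> \<and>
     (\<forall>X\<in>Obj B. \<epsilon> (omap F X) \<cdot>\<^bsub>A\<^esub> amap F (\<eta> X) = Ident A (omap F X)) \<and>
     (\<forall>V\<in>Obj A. amap U (\<epsilon> V) \<cdot>\<^bsub>B\<^esub> \<eta> (omap U V) = Ident B (omap U V))"

record ('o, 'm) comonad =
  cfunctor :: "('o, 'm, 'o, 'm) cat_functor"
  counit :: "'o \<Rightarrow> 'm"
  comult :: "'o \<Rightarrow> 'm"

definition adjunction_comonad ::
    "('p, 'q, 'o, 'm) cat_functor \<Rightarrow> ('o, 'm, 'p, 'q) cat_functor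
       \<Rightarrow> ('p \<Rightarrow> 'q) \<Rightarrow> ('o \<Rightarrow> 'm) \<Rightarrow> ('o, 'm) comonad" where
  "adjunction_comonad F U \<eta> \<epsilon> =
     \<lparr>cfunctor = comp_functor F U, counit = \<epsilon>, comult = (\<lambda>X. amap F (\<eta> (omap U X)))\<rparr>"


section \<open>Complexes of abelian groups\<close>

text \<open>A pair \<open>(C, \<delta>)\<close> stands for \<open>C 0 \<rightarrow> C 1 \<rightarrow> \<dots>\<close> with \<open>\<delta> n : C n \<rightarrow> C (n + 1)\<close>.\<close>

type_synonym 'g cochain = "(nat \<Rightarrow> 'g monoid) \<times> (nat \<Rightarrow> 'g \<Rightarrow> 'g)"

definition coboundaries :: "'g cochain \<Rightarrow> nat \<Rightarrow> 'g set" where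
  "coboundaries K n = (case n of
       0 \<Rightarrow> {\<one>\<^bsub>fst K 0\<^esub>}
     | Suc m \<Rightarrow> snd K m ` carrier (fst K m))"

definition cohomology :: "'g cochain \<Rightarrow> nat \<Rightarrow> 'g set monoid" where
  "cohomology K n =
     (fst K n)\<lparr>carrier := kernel (fst K n) (fst K (Suc n)) (snd K n)\<rparr> Mod coboundaries K n"

text \<open>A sequence \<open>0 \<leftarrow> V \<leftarrow> P 0 \<leftarrow> P 1 \<leftarrow> \<dots>\<close>, where \<open>d 0 : P 0 \<rightarrow> V\<close> is the augmentation.\<close>

definition augmented_seq :: "('o, 'm) cat \<Rightarrow> 'o \<Rightarrow> (nat \<Rightarrow> 'o) \<Rightarrow> (nat \<Rightarrow> 'm) \<Rightarrow> bool" where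
  "augmented_seq C V P d \<longleftrightarrow> V \<in> Obj C \<and> (\<forall>n. P n \<in> Obj C) \<and>
     d 0 \<in> homset C (P 0) V \<and> (\<forall>n. d (Suc n) \<in> homset C (P (Suc n)) (P n))"

text \<open>\<open>Hom(P, W)\<close>; the augmentation is dropped. Maps are restricted to the carriers, so that equality
  of cochains is equality of complexes.\<close>

definition hom_cochain :: "('o, 'm) cat \<Rightarrow> (nat \<Rightarrow> 'o) \<Rightarrow> (nat \<Rightarrow> 'm) \<Rightarrow> 'o \<Rightarrow> 'm cochain" where
  "hom_cochain C P d W =
     (\<lambda>n. homgrp C (P n) W, \<lambda>n. \<lambda>g\<in>homset C (P n) W. g \<cdot>\<^bsub>C\<^esub> d (Suc n))"


section \<open>Relative homological algebra\<close>

definition allowable ::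
    "('o, 'm) cat \<Rightarrow> ('p, 'q) cat \<Rightarrow> ('o, 'm, 'p, 'q) cat_functor \<Rightarrow> 'm \<Rightarrow> bool" where
  "allowable A B U f \<longleftrightarrow> f \<in> Arr A \<and>
     (\<exists>s\<in>homset B (omap U (Cod A f)) (omap U (Dom A f)).
        amap U f \<cdot>\<^bsub>B\<^esub> s \<cdot>\<^bsub>B\<^esub> amap U f = amap U f)"

definition relatively_projective ::
    "('o, 'm) cat \<Rightarrow> ('p, 'q) cat \<Rightarrow> ('o, 'm, 'p, 'q) cat_functor \<Rightarrow> 'o \<Rightarrow> bool" where
  "relatively_projective A B U P \<longleftrightarrow> P \<in> Obj A \<and>
     (\<forall>V W. \<forall>f\<in>homset A V W. allowable A B U f \<longrightarrow> is_epi A f \<longrightarrow>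
        (\<forall>g\<in>homset A P W. \<exists>h\<in>homset A P V. f \<cdot>\<^bsub>A\<^esub> h = g))"

definition relatively_projective_resolution ::
    "('o, 'm) cat \<Rightarrow> ('p, 'q) cat \<Rightarrow> ('o, 'm, 'p, 'q) cat_functor
       \<Rightarrow> 'o \<Rightarrow> (nat \<Rightarrow> 'o) \<Rightarrow> (nat \<Rightarrow> 'm) \<Rightarrow> bool" where
  "relatively_projective_resolution A B U V P d \<longleftrightarrow> augmented_seq A V P d \<and>
     (\<exists>Z. is_zero_object A Z \<and> exact_pair A (d 0) (ZeroArr A V Z)) \<and>
     (\<forall>n. exact_pair A (d (Suc n)) (d n)) \<and>
     (\<forall>n. relatively_projective A B U (P n)) \<and>
     (\<forall>n. allowable A B U (d n))"

text \<open>\<open>H\<close> is \<open>Ext\<^sup>n(V, W)\<close> computed by some relatively projective resolution of \<open>V\<close>.\<close>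

definition is_relative_Ext ::
    "('o, 'm) cat \<Rightarrow> ('p, 'q) cat \<Rightarrow> ('o, 'm, 'p, 'q) cat_functor
       \<Rightarrow> nat \<Rightarrow> 'o \<Rightarrow> 'o \<Rightarrow> 'm set monoid \<Rightarrow> bool" where
  "is_relative_Ext A B U n V W H \<longleftrightarrow>
     (\<exists>P d. relatively_projective_resolution A B U V P d \<and>
        H = cohomology (hom_cochain A P d W) n)"

text \<open>\<open>bar_diff\<close> is the differential \<open>d n : (FU)\<^sup>n\<^sup>+\<^sup>1 V \<rightarrow> (FU)\<^sup>n V\<close>; the alternating sum is a
  \<open>finprod\<close> in the (multiplicatively written) hom-group, where \<open>[^]\<close> is the integer multiple.\<close>

definition bar_ob ::
    "('p, 'q, 'o, 'm) cat_functor \<Rightarrow> ('o, 'm, 'p, 'q) cat_functor \<Rightarrow> 'o \<Rightarrow> nat \<Rightarrow> 'o" where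
  "bar_ob F U V n = ((omap F \<circ> omap U) ^^ (n + 1)) V"

definition bar_diff ::
    "('o, 'm) cat \<Rightarrow> ('p, 'q, 'o, 'm) cat_functor \<Rightarrow> ('o, 'm, 'p, 'q) cat_functor
       \<Rightarrow> ('o \<Rightarrow> 'm) \<Rightarrow> 'o \<Rightarrow> nat \<Rightarrow> 'm" where
  "bar_diff A F U \<epsilon> V n =
     (let H = homgrp A (((omap F \<circ> omap U) ^^ (n + 1)) V) (((omap F \<circ> omap U) ^^ n) V) in
      finprod H
        (\<lambda>i. ((amap F \<circ> amap U) ^^ (n - i)) (\<epsilon> (((omap F \<circ> omap U) ^^ i) V)) [^]\<^bsub>H\<^esub> ((- 1) ^ i :: int))
        {0..n})"

definition Bar_relative ::
    "('o, 'm) cat \<Rightarrow> ('p, 'q, 'o, 'm) cat_functor \<Rightarrow> ('o, 'm, 'p, 'q) cat_functor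
       \<Rightarrow> ('o \<Rightarrow> 'm) \<Rightarrow> 'o \<Rightarrow> 'o \<Rightarrow> 'm cochain" where
  "Bar_relative A F U \<epsilon> V W = hom_cochain A (bar_ob F U V) (bar_diff A F U \<epsilon> V) W"


section \<open>Comonad cohomology\<close>

definition G_projective :: "('o, 'm) cat \<Rightarrow> ('o, 'm) comonad \<Rightarrow> 'o \<Rightarrow> bool" where
  "G_projective A G P \<longleftrightarrow> P \<in> Obj A \<and>
     (\<exists>s\<in>homset A P (omap (cfunctor G) P). counit G P \<cdot>\<^bsub>A\<^esub> s = Ident A P)"

definition G_exact :: "('o, 'm) cat \<Rightarrow> ('o, 'm) comonad \<Rightarrow> 'm \<Rightarrow> 'm \<Rightarrow> bool" where
  "G_exact A G f g \<longleftrightarrow> f \<in> Arr A \<and> g \<in> Arr A \<and> Cod A f = Dom A g \<and>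
     g \<cdot>\<^bsub>A\<^esub> f = ZeroArr A (Dom A f) (Cod A g) \<and>
     (\<forall>V\<in>Obj A. let GV = omap (cfunctor G) V in
        exact_seq ([homgrp A GV (Cod A g), homgrp A GV (Dom A g), homgrp A GV (Dom A f)],
                   [\<lambda>h. g \<cdot>\<^bsub>A\<^esub> h, \<lambda>h. f \<cdot>\<^bsub>A\<^esub> h]))"

definition G_resolution ::
    "('o, 'm) cat \<Rightarrow> ('o, 'm) comonad \<Rightarrow> 'o \<Rightarrow> (nat \<Rightarrow> 'o) \<Rightarrow> (nat \<Rightarrow> 'm) \<Rightarrow> bool" where
  "G_resolution A G V P d \<longleftrightarrow> augmented_seq A V P d \<and>
     (\<exists>Z. is_zero_object A Z \<and> G_exact A G (d 0) (ZeroArr A V Z)) \<and>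
     (\<forall>n. G_exact A G (d (Suc n)) (d n)) \<and>
     (\<forall>n. G_projective A G (P n))"

text \<open>Coefficients of comonad cohomology: contravariant functors with values in abelian groups.\<close>

record ('o, 'm, 'g) contra_functor =
  cob :: "'o \<Rightarrow> 'g monoid"
  carr :: "'m \<Rightarrow> 'g \<Rightarrow> 'g"

definition is_additive_contra_functor ::
    "('o, 'm) cat \<Rightarrow> ('o, 'm, 'g) contra_functor \<Rightarrow> bool" where
  "is_additive_contra_functor C E \<longleftrightarrow>
     (\<forall>X\<in>Obj C. comm_group (cob E X)) \<and>
     (\<forall>X Y. \<forall>f\<in>homset C X Y. carr E f \<in> hom (cob E Y) (cob E X)) \<and>
     (\<forall>X\<in>Obj C. \<forall>x\<in>carrier (cob E X). carr E (Ident C X) x = x) \<and>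
     (\<forall>X Y Z. \<forall>g\<in>homset C Y Z. \<forall>f\<in>homset C X Y. \<forall>x\<in>carrier (cob E Z).
        carr E (g \<cdot>\<^bsub>C\<^esub> f) x = carr E f (carr E g x)) \<and>
     (\<forall>X Y. \<forall>f\<in>homset C X Y. \<forall>g\<in>homset C X Y. \<forall>x\<in>carrier (cob E Y).
        carr E (AddArr C f g) x = carr E f x \<otimes>\<^bsub>cob E X\<^esub> carr E g x)"

definition Hom_into :: "('o, 'm) cat \<Rightarrow> 'o \<Rightarrow> ('o, 'm, 'm) contra_functor" where
  "Hom_into C W =
     \<lparr>cob = (\<lambda>X. homgrp C X W), carr = (\<lambda>f. \<lambda>g\<in>homset C (Cod C f) W. g \<cdot>\<^bsub>C\<^esub> f)\<rparr>"

lemma (in preadditive_category) Hom_into_additive: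
  assumes "W \<in> Obj C"
  shows "is_additive_contra_functor C (Hom_into C W)"
proof -
  have obj: "X \<in> Obj C \<and> Y \<in> Obj C" if "f \<in> homset C X Y" for f X Y
    using that Dom_Obj Cod_Obj by (auto simp: homset_def)
  have add: "AddArr C f g \<in> homset C X Y" if "f \<in> homset C X Y" "g \<in> homset C X Y" for f g X Y
  proof -
    interpret H: comm_group "homgrp C X Y" using obj[OF that(1)] homgrp_comm_group by blast
    show ?thesis using H.m_closed[of f g] that by (simp add: homgrp_def)
  qed
  have cod: "Cod C f = Y" if "f \<in> homset C X Y" for f X Y
    using that by (simp add: homset_def)
  show ?thesis
    unfolding is_additive_contra_functor_def Hom_into_def
  proof (intro conjI ballI allI)
    fix X assume "X \<in> Obj C"
    then show "comm_group (cob \<lparr>cob = \<lambda>X. homgrp C X W,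
        carr = \<lambda>f. \<lambda>g\<in>homset C (Cod C f) W. g \<cdot> f\<rparr> X)"
      using homgrp_comm_group assms by simp
  qed (auto simp: homgrp_def hom_def cod[OF Ident_homset] cod[OF Comp_homset] cod[OF add] cod
        intro: Comp_homset add AddArr_Comp Comp_Ident Comp_AddArr Comp_assoc[symmetric])
qed

definition apply_contra ::
    "('o, 'm, 'g) contra_functor \<Rightarrow> (nat \<Rightarrow> 'o) \<Rightarrow> (nat \<Rightarrow> 'm) \<Rightarrow> 'g cochain" where
  "apply_contra E P d = (\<lambda>n. cob E (P n), \<lambda>n. carr E (d (Suc n)))"

text \<open>\<open>H\<close> is the comonad cohomology of \<open>V\<close> in degree \<open>n\<close> with coefficients in \<open>E\<close>, computed by some
  \<open>G\<close>-resolution of \<open>V\<close>.\<close>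

definition is_comonad_cohomology ::
    "('o, 'm) cat \<Rightarrow> ('o, 'm) comonad \<Rightarrow> nat \<Rightarrow> 'o \<Rightarrow> ('o, 'm, 'g) contra_functor
       \<Rightarrow> 'g set monoid \<Rightarrow> bool" where
  "is_comonad_cohomology A G n V E H \<longleftrightarrow>
     (\<exists>P d. G_resolution A G V P d \<and> H = cohomology (apply_contra E P d) n)"

definition G_bar_ob :: "('o, 'm) comonad \<Rightarrow> 'o \<Rightarrow> nat \<Rightarrow> 'o" where
  "G_bar_ob G V n = (omap (cfunctor G) ^^ (n + 1)) V"

definition G_bar_diff :: "('o, 'm) cat \<Rightarrow> ('o, 'm) comonad \<Rightarrow> 'o \<Rightarrow> nat \<Rightarrow> 'm" where
  "G_bar_diff A G V n =
     (let H = homgrp A ((omap (cfunctor G) ^^ (n + 1)) V) ((omap (cfunctor G) ^^ n) V) in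
      finprod H
        (\<lambda>i. (amap (cfunctor G) ^^ (n - i)) (counit G ((omap (cfunctor G) ^^ i) V))
               [^]\<^bsub>H\<^esub> ((- 1) ^ i :: int))
        {0..n})"

definition Bar_comonad ::
    "('o, 'm) cat \<Rightarrow> ('o, 'm) comonad \<Rightarrow> 'o \<Rightarrow> ('o, 'm, 'g) contra_functor \<Rightarrow> 'g cochain" where
  "Bar_comonad A G V E = apply_contra E (G_bar_ob G V) (G_bar_diff A G V)"

end

theory Submission
  imports Defs
begin

text \<open>
  Both theories are governed by one fact: for \<open>T\<close> in \<open>B\<close>, arrows \<open>F T \<rightarrow> Y\<close> in \<open>A\<close> are the same as arrows
  \<open>T \<rightarrow> U Y\<close> in \<open>B\<close>. Whatever splits after \<open>U\<close> has been applied can thus be lifted from the objects \<open>G V\<close>,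
  and conversely, lifting the counit yields a splitting in \<open>B\<close>.

  \<^item> Projectives. The counit \<open>\<epsilon> P\<close> is an allowable epi: its image under \<open>U\<close> is split by the unit, and the
    faithful \<open>U\<close> reflects epis. So relatively projective objects are \<open>G\<close>-projective. Conversely, \<open>U\<close> preserves epis
    because it is exact, so an allowable epi becomes split epi in \<open>B\<close>, and arrows from \<open>G P\<close> lift along
    it (lemma \<open>allowable_lift\<close>); this passes to retracts.

  \<^item> Resolutions. Both kinds of exactness are expressed through the comparison map \<open>e\<close> in \<open>f = k \<cdot> e\<close>,
    where \<open>k\<close> is the kernel of \<open>g\<close>. If \<open>f\<close> is allowable and \<open>e\<close> is epi, then \<open>allowable_lift\<close> gives
    \<open>G\<close>-exactness. Conversely, \<open>G\<close>-exactness makes the counit of the kernel factor through \<open>e\<close>, which is then epi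
    and even split epi in \<open>B\<close>. By induction from the augmentation onwards, the inclusion of each kernel
    becomes split mono in \<open>B\<close>, and so each differential is allowable (lemma \<open>G_exact_allowable\<close>).

  \<^item> Bar complexes. They agree by unfolding, since \<open>G = F U\<close> as functors.

  \<^item> Cohomology. A resolution exists by covering successive kernels with their counits. Any two resolutions
    of \<open>V\<close> are homotopy equivalent by the comparison theorem, which is proved here for augmented
    complexes in a preadditive category from the lifting properties alone; hence
    \<open>comparison_cohomology_iso\<close>.
\<close>


section \<open>Arithmetic of hom-groups\<close>

lemma homgrp_simps [simp]:
  "carrier (homgrp C X Y) = homset C X Y"
  "mult (homgrp C X Y) = AddArr C"
  "one (homgrp C X Y) = ZeroArr C X Y"
  by (simp_all add: homgrp_def)

context category
begin

lemma homsetD: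
  assumes "f \<in> homset C X Y"
  shows "f \<in> Arr C" "Dom C f = X" "Cod C f = Y" "X \<in> Obj C" "Y \<in> Obj C"
  using assms Dom_Obj Cod_Obj by (auto simp: homset_def)

lemma Arr_homset: "f \<in> Arr C \<Longrightarrow> f \<in> homset C (Dom C f) (Cod C f)"
  by (simp add: homset_def)

end

context preadditive_category
begin

lemma homgrp_group: "X \<in> Obj C \<Longrightarrow> Y \<in> Obj C \<Longrightarrow> group (homgrp C X Y)"
  using homgrp_comm_group comm_group.axioms(2) by blast

lemma Zero_homset:
  assumes "X \<in> Obj C" "Y \<in> Obj C"
  shows "ZeroArr C X Y \<in> homset C X Y"
  using group.is_monoid[OF homgrp_group[OF assms]] monoid.one_closed
  by (fastforce simp: homgrp_def)

lemma AddArr_homset: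
  assumes "f \<in> homset C X Y" "g \<in> homset C X Y"
  shows "AddArr C f g \<in> homset C X Y"
  using monoid.m_closed[OF group.is_monoid[OF homgrp_group], of X Y f g] homsetD[OF assms(1)] assms
  by (simp add: homgrp_def)

lemma precompose_hom:
  assumes "f \<in> homset C X Y" "W \<in> Obj C"
  shows "(\<lambda>g. g \<cdot> f) \<in> hom (homgrp C Y W) (homgrp C X W)"
  using assms by (auto simp: hom_def homgrp_def intro: Comp_homset AddArr_Comp)

lemma postcompose_hom:
  assumes "f \<in> homset C X Y" "T \<in> Obj C"
  shows "(\<lambda>g. f \<cdot> g) \<in> hom (homgrp C T X) (homgrp C T Y)"
  using assms by (auto simp: hom_def homgrp_def intro: Comp_homset Comp_AddArr)

lemma Zero_Comp:
  assumes "f \<in> homset C X Y" "W \<in> Obj C"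
  shows "ZeroArr C Y W \<cdot> f = ZeroArr C X W"
  using hom_one[OF precompose_hom[OF assms] homgrp_group homgrp_group] homsetD[OF assms(1)] assms(2)
  by (simp add: homgrp_def)

lemma Comp_Zero:
  assumes "f \<in> homset C X Y" "T \<in> Obj C"
  shows "f \<cdot> ZeroArr C T X = ZeroArr C T Y"
  using hom_one[OF postcompose_hom[OF assms] homgrp_group homgrp_group] homsetD[OF assms(1)] assms(2)
  by (simp add: homgrp_def)

text \<open>
  Hom-groups are multiplicative structures, one for each pair of objects, whereas homotopies are most
  legible with a subtraction of parallel arrows; the domain and codomain of \<open>f\<close> tell in which group
  it takes place.
\<close>

definition diff_arr :: "'b \<Rightarrow> 'b \<Rightarrow> 'b"
  where "diff_arr f g = AddArr C f (inv\<^bsub>homgrp C (Dom C f) (Cod C f)\<^esub> g)"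

lemma diff_arr_eq:
  assumes "f \<in> homset C X Y"
  shows "diff_arr f g = AddArr C f (inv\<^bsub>homgrp C X Y\<^esub> g)"
  using homsetD[OF assms] by (simp add: diff_arr_def)

lemma inv_homset:
  assumes "f \<in> homset C X Y"
  shows "inv\<^bsub>homgrp C X Y\<^esub> f \<in> homset C X Y"
  using group.inv_closed[OF homgrp_group] homsetD[OF assms] assms by simp

lemma diff_homset:
  assumes "f \<in> homset C X Y" "g \<in> homset C X Y"
  shows "diff_arr f g \<in> homset C X Y"
  unfolding diff_arr_eq[OF assms(1)] using AddArr_homset inv_homset assms by blast

text \<open>
  In place of a calculus of subtraction, identities between differences are turned into identities
  between sums.
\<close>

lemma eq_diff_iff:
  assumes "f \<in> homset C X Y" "g \<in> homset C X Y" "k \<in> homset C X Y"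
  shows "k = diff_arr f g \<longleftrightarrow> f = AddArr C k g"
proof -
  interpret H: group "homgrp C X Y" using homgrp_group homsetD[OF assms(1)] by blast
  show ?thesis
    using H.inv_solve_right[of k f g] assms by (simp add: diff_arr_eq[OF assms(1)])
qed

lemma AddArr_commute:
  assumes "f \<in> homset C X Y" "g \<in> homset C X Y"
  shows "AddArr C f g = AddArr C g f"
  using comm_monoid.m_comm[OF comm_group.axioms(1)[OF homgrp_comm_group], of X Y f g]
    homsetD[OF assms(1)] assms by simp

lemma Zero_AddArr:
  assumes "f \<in> homset C X Y"
  shows "AddArr C (ZeroArr C X Y) f = f"
  using monoid.l_one[OF group.is_monoid[OF homgrp_group], of X Y f] homsetD[OF assms] assms by simp

lemma diff_eq_Zero_iff:
  assumes "f \<in> homset C X Y" "g \<in> homset C X Y"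
  shows "diff_arr f g = ZeroArr C X Y \<longleftrightarrow> f = g"
  using eq_diff_iff[OF assms Zero_homset] Zero_AddArr[OF assms(2)] homsetD[OF assms(1)] by metis

lemma hom_homgrp_diff:
  assumes \<phi>: "\<phi> \<in> hom (homgrp C X Y) (homgrp C X' Y')"
    and fg: "f \<in> homset C X Y" "g \<in> homset C X Y"
  shows "\<phi> (diff_arr f g) = diff_arr (\<phi> f) (\<phi> g)"
proof -
  have mem: "\<phi> k \<in> homset C X' Y'" if "k \<in> homset C X Y" for k
    using hom_in_carrier[OF \<phi>, of k] that by simp
  have "\<phi> f = AddArr C (\<phi> (diff_arr f g)) (\<phi> g)"
    using hom_mult[OF \<phi>, of "diff_arr f g" g] eq_diff_iff[OF fg diff_homset[OF fg]] diff_homset[OF fg] fg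
    by simp
  then show ?thesis using eq_diff_iff mem diff_homset fg by blast
qed

lemma diff_Comp:
  assumes "f \<in> homset C Y Z" "g \<in> homset C Y Z" "h \<in> homset C X Y"
  shows "diff_arr f g \<cdot> h = diff_arr (f \<cdot> h) (g \<cdot> h)"
  using hom_homgrp_diff[OF precompose_hom] assms homsetD[OF assms(3)] homsetD[OF assms(1)] by blast

lemma Comp_diff:
  assumes "h \<in> homset C Y Z" "f \<in> homset C X Y" "g \<in> homset C X Y"
  shows "h \<cdot> diff_arr f g = diff_arr (h \<cdot> f) (h \<cdot> g)"
  using hom_homgrp_diff[OF postcompose_hom] assms homsetD[OF assms(2)] homsetD[OF assms(1)] by blast

lemma is_epi_if_cancels_Zero:
  assumes e: "e \<in> homset C X Y"
    and "\<And>T t. t \<in> homset C Y T \<Longrightarrow> t \<cdot> e = ZeroArr C X T \<Longrightarrow> t = ZeroArr C Y T"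
  shows "is_epi C e"
proof -
  have "g = h" if "g \<in> homset C Y T" "h \<in> homset C Y T" "g \<cdot> e = h \<cdot> e" for T g h
  proof -
    have "diff_arr g h \<cdot> e = ZeroArr C X T"
      using diff_Comp[OF that(1,2) e] that Comp_homset[OF _ e] by (simp add: diff_eq_Zero_iff)
    then show ?thesis using assms(2) diff_homset diff_eq_Zero_iff that by blast
  qed
  then show ?thesis using homsetD[OF e] by (simp add: is_epi_def)
qed

end


section \<open>The comparison theorem\<close>

text \<open>
  The common ground of both theories: \<open>Hom(X, -)\<close> turns the augmented sequence into an exact one.
  The comparison theorem asks nothing else of the terms of two resolutions, so that it can be proved in
  any preadditive category and with no choice of a class of projectives.
\<close>

definition acyclic_against ::
    "('o, 'm) cat \<Rightarrow> 'o \<Rightarrow> 'o \<Rightarrow> (nat \<Rightarrow> 'o) \<Rightarrow> (nat \<Rightarrow> 'm) \<Rightarrow> bool" where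
  "acyclic_against C X V Q e \<longleftrightarrow>
     (\<forall>x\<in>homset C X V. \<exists>y\<in>homset C X (Q 0). e 0 \<cdot>\<^bsub>C\<^esub> y = x) \<and>
     (\<forall>n. \<forall>x\<in>homset C X (Q n). e n \<cdot>\<^bsub>C\<^esub> x = ZeroArr C X (Cod C (e n)) \<longrightarrow>
        (\<exists>y\<in>homset C X (Q (Suc n)). e (Suc n) \<cdot>\<^bsub>C\<^esub> y = x))"

text \<open>
  The codomain of \<open>d 0\<close> is \<open>V\<close> and that of \<open>d (n + 1)\<close> is \<open>P n\<close>; writing
  \<open>Cod C (d n)\<close> treats the augmentation and the differentials alike.
\<close>

definition is_complex :: "('o, 'm) cat \<Rightarrow> 'o \<Rightarrow> (nat \<Rightarrow> 'o) \<Rightarrow> (nat \<Rightarrow> 'm) \<Rightarrow> bool" where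
  "is_complex C V P d \<longleftrightarrow> augmented_seq C V P d \<and>
     (\<forall>n. d n \<cdot>\<^bsub>C\<^esub> d (Suc n) = ZeroArr C (P (Suc n)) (Cod C (d n)))"

definition is_chain_map ::
    "('o, 'm) cat \<Rightarrow> (nat \<Rightarrow> 'o) \<Rightarrow> (nat \<Rightarrow> 'm) \<Rightarrow> (nat \<Rightarrow> 'o) \<Rightarrow> (nat \<Rightarrow> 'm) \<Rightarrow> (nat \<Rightarrow> 'm) \<Rightarrow> bool" where
  "is_chain_map C P d Q e f \<longleftrightarrow> (\<forall>n. f n \<in> homset C (P n) (Q n)) \<and>
     (\<forall>n. e (Suc n) \<cdot>\<^bsub>C\<^esub> f (Suc n) = f n \<cdot>\<^bsub>C\<^esub> d (Suc n))"

lemma augmented_seqD: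
  assumes "augmented_seq C V P d"
  shows "V \<in> Obj C" "P n \<in> Obj C" "d 0 \<in> homset C (P 0) V"
    "d (Suc n) \<in> homset C (P (Suc n)) (P n)" "d n \<in> homset C (P n) (Cod C (d n))"
    "Cod C (d 0) = V" "Cod C (d (Suc n)) = P n"
  using assms unfolding augmented_seq_def homset_def by (auto, (cases n; auto)+)

context preadditive_category
begin

text \<open>
  Existence half of the comparison theorem: the identity of \<open>V\<close> lifts degree by degree.
\<close>

lemma chain_map_exists:
  assumes P: "is_complex C V P d" and Q: "is_complex C V Q e"
    and acyclic: "\<And>n. acyclic_against C (P n) V Q e"
  obtains f where "is_chain_map C P d Q e f" "e 0 \<cdot> f 0 = d 0"
proof -
  have aP: "augmented_seq C V P d" and aQ: "augmented_seq C V Q e"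
    and dd: "d n \<cdot> d (Suc n) = ZeroArr C (P (Suc n)) (Cod C (d n))" for n
    using P Q by (auto simp: is_complex_def)
  note [simp] = augmented_seqD(6,7)[OF aP] augmented_seqD(6,7)[OF aQ]
  note hP = augmented_seqD(1-5)[OF aP] and hQ = augmented_seqD(1-5)[OF aQ]
  \<comment> \<open>The construction continues past degree \<open>n\<close> because \<open>f n \<cdot> d (Suc n)\<close> is a cycle; the last
    conjunct records the compatibility of \<open>f 0\<close> with the augmentations.\<close>
  let ?I = "\<lambda>n f. f \<in> homset C (P n) (Q n) \<and>
    e n \<cdot> (f \<cdot> d (Suc n)) = ZeroArr C (P (Suc n)) (Cod C (e n)) \<and> (n = 0 \<longrightarrow> e 0 \<cdot> f = d 0)"
  have "\<exists>f. \<forall>n. ?I n (f n) \<and> e (Suc n) \<cdot> f (Suc n) = f n \<cdot> d (Suc n)"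
  proof (rule dependent_nat_choice)
    obtain f0 where "f0 \<in> homset C (P 0) (Q 0)" "e 0 \<cdot> f0 = d 0"
      using acyclic hP(3) unfolding acyclic_against_def by blast
    then show "\<exists>f. ?I 0 f"
      using dd[of 0] Comp_assoc[OF hQ(3) _ hP(4), of f0 0] by auto
  next
    fix f n assume I: "?I n f"
    then have "f \<cdot> d (Suc n) \<in> homset C (P (Suc n)) (Q n)" using Comp_homset hP by blast
    then obtain f' where f': "f' \<in> homset C (P (Suc n)) (Q (Suc n))" "e (Suc n) \<cdot> f' = f \<cdot> d (Suc n)"
      using acyclic I unfolding acyclic_against_def by blast
    have "e (Suc n) \<cdot> (f' \<cdot> d (Suc (Suc n))) = (f \<cdot> d (Suc n)) \<cdot> d (Suc (Suc n))"
      using Comp_assoc[OF hQ(4) f'(1) hP(4)] f'(2) by simp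
    also have "\<dots> = f \<cdot> ZeroArr C (P (Suc (Suc n))) (P n)"
      using Comp_assoc[OF _ hP(4) hP(4), of f n "Q n"] I dd[of "Suc n"] by simp
    also have "\<dots> = ZeroArr C (P (Suc (Suc n))) (Q n)" using Comp_Zero I hP by blast
    finally show "\<exists>f'. ?I (Suc n) f' \<and> e (Suc n) \<cdot> f' = f \<cdot> d (Suc n)"
      using f' by (intro exI[of _ f']) simp
  qed
  then show thesis using that unfolding is_chain_map_def by blast
qed

text \<open>
  Uniqueness half of the comparison theorem: a chain map \<open>w\<close> that covers zero on \<open>V\<close> is null
  homotopic. The arrow \<open>w (n + 1) - h n \<cdot> d (n + 1)\<close> is a cycle and so lifts to \<open>h (n + 1)\<close>,
  because \<open>(w n - e (n + 1) \<cdot> h n) \<cdot> d (n + 1)\<close> vanishes: the first factor is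
  \<open>h (n - 1) \<cdot> d n\<close> by construction (and zero if \<open>n = 0\<close>), and \<open>d n \<cdot> d (n + 1) = 0\<close>. This vanishing is the invariant
  carried along the construction.
\<close>

lemma null_homotopy_exists:
  assumes P: "is_complex C V P d" and Q: "is_complex C V Q e"
    and acyclic: "\<And>n. acyclic_against C (P n) V Q e"
    and w: "is_chain_map C P d Q e w" and w0: "e 0 \<cdot> w 0 = ZeroArr C (P 0) V"
  obtains h where "\<And>n. h n \<in> homset C (P n) (Q (Suc n))" "w 0 = e 1 \<cdot> h 0"
    "\<And>n. diff_arr (w (Suc n)) (h n \<cdot> d (Suc n)) = e (Suc (Suc n)) \<cdot> h (Suc n)"
proof -
  have aP: "augmented_seq C V P d" and aQ: "augmented_seq C V Q e"
    and dd: "d n \<cdot> d (Suc n) = ZeroArr C (P (Suc n)) (Cod C (d n))" for n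
    using P Q by (auto simp: is_complex_def)
  note [simp] = augmented_seqD(6,7)[OF aP] augmented_seqD(6,7)[OF aQ]
  note hP = augmented_seqD(1-5)[OF aP] and hQ = augmented_seqD(1-5)[OF aQ]
  have hw: "w n \<in> homset C (P n) (Q n)" and ew: "e (Suc n) \<cdot> w (Suc n) = w n \<cdot> d (Suc n)" for n
    using w by (auto simp: is_chain_map_def)
  \<comment> \<open>The last conjunct keeps the homotopy relation in degree zero, which the recursion does not produce.\<close>
  let ?I = "\<lambda>n h. h \<in> homset C (P n) (Q (Suc n)) \<and>
    diff_arr (w n) (e (Suc n) \<cdot> h) \<cdot> d (Suc n) = ZeroArr C (P (Suc n)) (Q n) \<and>
    (n = 0 \<longrightarrow> w 0 = e 1 \<cdot> h)"
  have "\<exists>h. \<forall>n. ?I n (h n) \<and>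
      diff_arr (w (Suc n)) (h n \<cdot> d (Suc n)) = e (Suc (Suc n)) \<cdot> h (Suc n)"
  proof (rule dependent_nat_choice)
    obtain h where h: "h \<in> homset C (P 0) (Q (Suc 0))" "e (Suc 0) \<cdot> h = w 0"
      using acyclic[of 0] hw[of 0] w0 unfolding acyclic_against_def by force
    then show "\<exists>h. ?I 0 h"
      using diff_eq_Zero_iff[OF hw hw, THEN iffD2] Zero_Comp[OF hP(4) hQ(2)]
      by (intro exI[of _ h]) simp
  next
    fix h n assume I: "?I n h"
    then have h: "h \<in> homset C (P n) (Q (Suc n))" by blast
    have hd: "h \<cdot> d (Suc n) \<in> homset C (P (Suc n)) (Q (Suc n))" using Comp_homset h hP(4) by blast
    let ?w' = "diff_arr (w (Suc n)) (h \<cdot> d (Suc n))"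
    have w': "?w' \<in> homset C (P (Suc n)) (Q (Suc n))" using diff_homset hw hd by blast
    have "e (Suc n) \<cdot> ?w' = diff_arr (w n \<cdot> d (Suc n)) ((e (Suc n) \<cdot> h) \<cdot> d (Suc n))"
      using Comp_diff[OF hQ(4) hw hd] ew Comp_assoc[OF hQ(4) h hP(4)] by simp
    also have "\<dots> = diff_arr (w n) (e (Suc n) \<cdot> h) \<cdot> d (Suc n)"
      using diff_Comp[OF hw Comp_homset[OF hQ(4) h] hP(4)] by simp
    also have "\<dots> = ZeroArr C (P (Suc n)) (Q n)" using I by blast
    finally obtain h' where h': "h' \<in> homset C (P (Suc n)) (Q (Suc (Suc n)))"
      "e (Suc (Suc n)) \<cdot> h' = ?w'"
      using acyclic[of "Suc n"] w' unfolding acyclic_against_def by force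
    have "diff_arr (w (Suc n)) ?w' = h \<cdot> d (Suc n)"
      using eq_diff_iff[OF hw w' hd] eq_diff_iff[OF hw hd w'] AddArr_commute[OF hd w'] by simp
    moreover have "(h \<cdot> d (Suc n)) \<cdot> d (Suc (Suc n)) = ZeroArr C (P (Suc (Suc n))) (Q (Suc n))"
      using Comp_assoc[OF h hP(4) hP(4)] dd[of "Suc n"] Comp_Zero[OF h hP(2)] by simp
    ultimately show "\<exists>h'. ?I (Suc n) h' \<and> ?w' = e (Suc (Suc n)) \<cdot> h'"
      using h' by (intro exI[of _ h']) simp
  qed
  then show thesis using that by blast
qed

end


section \<open>Cohomology of homotopy equivalent complexes\<close>

text \<open>
  The isomorphism is induced by \<open>\<phi>\<close>, through the first isomorphism theorem for the map
  from \<open>Z\<close> to the quotient of \<open>Z'\<close>. Both its surjectivity and the fact that its kernel is no larger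
  than \<open>B\<close> come from \<open>\<psi>\<close> being an inverse up to elements of \<open>B\<close> and \<open>B'\<close>.
\<close>

lemma subquotient_iso:
  fixes M :: "('a, 'x) monoid_scheme" and N :: "('b, 'y) monoid_scheme"
  assumes M: "comm_group M" "subgroup Z M" "subgroup B M" "B \<subseteq> Z"
    and N: "comm_group N" "subgroup Z' N" "subgroup B' N" "B' \<subseteq> Z'"
    and \<phi>: "\<phi> \<in> hom M N" "\<phi> ` Z \<subseteq> Z'" "\<phi> ` B \<subseteq> B'"
    and \<psi>: "\<psi> ` Z' \<subseteq> Z" "\<psi> ` B' \<subseteq> B"
    and \<psi>\<phi>: "\<And>x. x \<in> Z \<Longrightarrow> \<exists>b\<in>B. \<psi> (\<phi> x) = b \<otimes>\<^bsub>M\<^esub> x"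
    and \<phi>\<psi>: "\<And>y. y \<in> Z' \<Longrightarrow> \<exists>b\<in>B'. \<phi> (\<psi> y) = b \<otimes>\<^bsub>N\<^esub> y"
  shows "M\<lparr>carrier := Z\<rparr> Mod B \<cong> N\<lparr>carrier := Z'\<rparr> Mod B'"
proof -
  let ?M = "M\<lparr>carrier := Z\<rparr>" and ?N = "N\<lparr>carrier := Z'\<rparr>"
  interpret M: comm_group M by fact
  interpret N: comm_group N by fact
  interpret M': group ?M using M.subgroup_imp_group M(2) .
  interpret N': comm_group ?N
    using N.m_comm subgroup.mem_carrier[OF N(2)]
    by (intro group.group_comm_groupI N.subgroup_imp_group N(2)) auto
  interpret Nq: normal B' ?N
    using N.subgroup_incl[OF N(3,2,4)] N'.subgroup_imp_normal by blast
  let ?\<pi> = "\<lambda>x. B' #>\<^bsub>?N\<^esub> \<phi> x"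
  have "\<phi> \<in> hom ?M ?N"
    using \<phi>(1,2) subgroup.subset[OF M(2)] unfolding hom_def by (auto simp: subset_iff)
  then have "?\<pi> \<in> hom ?M (?N Mod B')"
    using hom_compose[OF _ Nq.r_coset_hom_Mod, of \<phi> ?M] by (simp add: o_def)
  then interpret \<pi>: group_hom ?M "?N Mod B'" ?\<pi>
    using M'.group_axioms Nq.factorgroup_is_group by (simp add: group_hom_def group_hom_axioms_def)
  have coset: "B' #>\<^bsub>?N\<^esub> y = B' \<longleftrightarrow> y \<in> B'" if "y \<in> Z'" for y
    using N'.coset_join1[of B' y] N'.coset_join2[of y B'] Nq.subgroup_axioms that by auto
  have "?\<pi> ` carrier ?M = carrier (?N Mod B')"
  proof
    show "?\<pi> ` carrier ?M \<subseteq> carrier (?N Mod B')" using \<pi>.hom_closed by blast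
    show "carrier (?N Mod B') \<subseteq> ?\<pi> ` carrier ?M"
    proof
      fix c assume "c \<in> carrier (?N Mod B')"
      then obtain y where y: "y \<in> Z'" "c = B' #>\<^bsub>?N\<^esub> y" by (auto simp: carrier_FactGroup)
      obtain b where b: "b \<in> B'" "\<phi> (\<psi> y) = b \<otimes>\<^bsub>N\<^esub> y" using \<phi>\<psi> y(1) by blast
      have "\<phi> (\<psi> y) \<in> B' #>\<^bsub>?N\<^esub> y" using b by (auto simp: r_coset_def)
      then have "c = ?\<pi> (\<psi> y)"
        using N'.repr_independence[of "\<phi> (\<psi> y)" B' y] y Nq.subgroup_axioms by simp
      then show "c \<in> ?\<pi> ` carrier ?M" using \<psi>(1) y(1) by auto
    qed
  qed
  moreover have "kernel ?M (?N Mod B') ?\<pi> = B"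
  proof -
    have "x \<in> B" if x: "x \<in> Z" "\<phi> x \<in> B'" for x
    proof -
      obtain b where b: "b \<in> B" "\<psi> (\<phi> x) = b \<otimes>\<^bsub>M\<^esub> x" using \<psi>\<phi> x(1) by blast
      have "b \<otimes>\<^bsub>M\<^esub> x \<in> B" using \<psi>(2) x(2) b(2) by (metis image_subset_iff)
      moreover have "x = inv\<^bsub>M\<^esub> b \<otimes>\<^bsub>M\<^esub> (b \<otimes>\<^bsub>M\<^esub> x)"
        using M.inv_solve_left[of x b "b \<otimes>\<^bsub>M\<^esub> x"] b(1) x(1) subgroup.subset[OF M(2)] subgroup.subset[OF M(3)]
        by auto
      ultimately show ?thesis
        using b(1) subgroup.m_closed[OF M(3)] subgroup.m_inv_closed[OF M(3)] by metis
    qed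
    moreover have "\<phi> x \<in> Z'" if "x \<in> Z" for x using \<phi>(2) that by blast
    moreover have "\<phi> x \<in> B'" if "x \<in> B" for x using \<phi>(3) that by blast
    ultimately have "x \<in> Z \<and> ?\<pi> x = B' \<longleftrightarrow> x \<in> B" for x
      using coset[of "\<phi> x"] M(4) by blast
    then show ?thesis by (simp add: kernel_def)
  qed
  ultimately show ?thesis using \<pi>.FactGroup_iso by simp
qed

context preadditive_category
begin

lemma hom_cochain_simps:
  "fst (hom_cochain C P d W) n = homgrp C (P n) W"
  "snd (hom_cochain C P d W) n = (\<lambda>g\<in>homset C (P n) W. g \<cdot> d (Suc n))"
  by (simp_all add: hom_cochain_def)

lemma coboundaries_hom_cochain:
  "coboundaries (hom_cochain C P d W) n =
     (case n of 0 \<Rightarrow> {ZeroArr C (P 0) W} | Suc m \<Rightarrow> (\<lambda>g. g \<cdot> d (Suc m)) ` homset C (P m) W)"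
  by (auto simp: coboundaries_def hom_cochain_simps split: nat.split)

lemma mem_coboundaries_hom_cochain:
  "x \<in> coboundaries (hom_cochain C P d W) n \<longleftrightarrow>
     (case n of 0 \<Rightarrow> x = ZeroArr C (P 0) W | Suc m \<Rightarrow> \<exists>y\<in>homset C (P m) W. x = y \<cdot> d (Suc m))"
  by (auto simp: coboundaries_hom_cochain split: nat.split)

definition hom_cocycles :: "(nat \<Rightarrow> 'a) \<Rightarrow> (nat \<Rightarrow> 'b) \<Rightarrow> 'a \<Rightarrow> nat \<Rightarrow> 'b set" where
  "hom_cocycles P d W n = {x \<in> homset C (P n) W. x \<cdot> d (Suc n) = ZeroArr C (P (Suc n)) W}"

lemma cohomology_hom_cochain:
  "cohomology (hom_cochain C P d W) n =
     (homgrp C (P n) W)\<lparr>carrier := hom_cocycles P d W n\<rparr> Mod coboundaries (hom_cochain C P d W) n"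
proof -
  have "kernel (homgrp C (P n) W) (homgrp C (P (Suc n)) W) (\<lambda>g\<in>homset C (P n) W. g \<cdot> d (Suc n)) =
      hom_cocycles P d W n"
    by (auto simp: kernel_def hom_cocycles_def)
  then show ?thesis by (simp add: cohomology_def hom_cochain_simps)
qed

lemma subgroups_hom_cochain:
  assumes P: "is_complex C V P d" and W: "W \<in> Obj C"
  shows "subgroup (hom_cocycles P d W n) (homgrp C (P n) W)"
    and "subgroup (coboundaries (hom_cochain C P d W) n) (homgrp C (P n) W)"
    and "coboundaries (hom_cochain C P d W) n \<subseteq> hom_cocycles P d W n"
proof -
  have aP: "augmented_seq C V P d"
    and dd: "d n \<cdot> d (Suc n) = ZeroArr C (P (Suc n)) (Cod C (d n))" for n
    using P by (auto simp: is_complex_def)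
  note hP = augmented_seqD(1-5)[OF aP]
  have gh: "group_hom (homgrp C (P n) W) (homgrp C (P (Suc n)) W) (\<lambda>g. g \<cdot> d (Suc n))" for n
    using precompose_hom[OF hP(4) W] homgrp_group hP(2) W
    by (simp add: group_hom_def group_hom_axioms_def)
  show "subgroup (hom_cocycles P d W n) (homgrp C (P n) W)"
    using group_hom.subgroup_kernel[OF gh, of n] by (simp add: kernel_def hom_cocycles_def)
  show "subgroup (coboundaries (hom_cochain C P d W) n) (homgrp C (P n) W)"
  proof (cases n)
    case 0
    then show ?thesis
      using group.triv_subgroup[OF homgrp_group[OF hP(2) W], of 0]
      by (simp add: coboundaries_hom_cochain)
  next
    case (Suc m)
    then show ?thesis
      using group_hom.img_is_subgroup[OF gh, of m]
      by (simp add: coboundaries_hom_cochain)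
  qed
  show "coboundaries (hom_cochain C P d W) n \<subseteq> hom_cocycles P d W n"
  proof (cases n)
    case 0
    then show ?thesis
      using Zero_homset[OF hP(2) W] Zero_Comp[OF hP(4) W]
      by (auto simp: coboundaries_hom_cochain hom_cocycles_def)
  next
    case (Suc m)
    have "y \<cdot> d (Suc m) \<in> hom_cocycles P d W (Suc m)" if y: "y \<in> homset C (P m) W" for y
      using Comp_assoc[OF y hP(4) hP(4)] dd[of "Suc m"] Comp_Zero[OF y hP(2)] Comp_homset[OF y hP(4)]
        augmented_seqD(7)[OF aP]
      by (simp add: hom_cocycles_def)
    then show ?thesis using Suc by (auto simp: coboundaries_hom_cochain)
  qed
qed

lemma precompose_chain_map:
  assumes P: "is_complex C V P d" and Q: "is_complex C V Q e" and W: "W \<in> Obj C"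
    and f: "is_chain_map C P d Q e f"
  shows "(\<lambda>x. x \<cdot> f n) ` hom_cocycles Q e W n \<subseteq> hom_cocycles P d W n"
    and "(\<lambda>x. x \<cdot> f n) ` coboundaries (hom_cochain C Q e W) n \<subseteq> coboundaries (hom_cochain C P d W) n"
proof -
  have hP: "d (Suc n) \<in> homset C (P (Suc n)) (P n)" and hQ: "e (Suc n) \<in> homset C (Q (Suc n)) (Q n)" for n
    using P Q by (auto simp: is_complex_def augmented_seq_def)
  have hf: "f n \<in> homset C (P n) (Q n)" and ef: "e (Suc n) \<cdot> f (Suc n) = f n \<cdot> d (Suc n)" for n
    using f by (auto simp: is_chain_map_def)
  have swap: "(x \<cdot> f n) \<cdot> d (Suc n) = (x \<cdot> e (Suc n)) \<cdot> f (Suc n)" if "x \<in> homset C (Q n) W" for x n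
    using Comp_assoc[OF that hf hP] Comp_assoc[OF that hQ hf] ef by simp
  show "(\<lambda>x. x \<cdot> f n) ` hom_cocycles Q e W n \<subseteq> hom_cocycles P d W n"
    using swap Comp_homset[OF _ hf] Zero_Comp[OF hf W] by (auto simp: hom_cocycles_def)
  show "(\<lambda>x. x \<cdot> f n) ` coboundaries (hom_cochain C Q e W) n \<subseteq> coboundaries (hom_cochain C P d W) n"
  proof (cases n)
    case 0
    then show ?thesis using Zero_Comp[OF hf W] by (auto simp: mem_coboundaries_hom_cochain)
  next
    case (Suc m)
    have "(y \<cdot> e (Suc m)) \<cdot> f (Suc m) \<in> coboundaries (hom_cochain C P d W) (Suc m)"
      if y: "y \<in> homset C (Q m) W" for y
      using swap[OF y] Comp_homset[OF y hf] by (auto simp: mem_coboundaries_hom_cochain intro!: bexI[of _ "y \<cdot> f m"])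
    then show ?thesis using Suc by (auto simp: mem_coboundaries_hom_cochain)
  qed
qed

lemma chain_map_comp_minus_id:
  assumes P: "is_complex C V P d" and Q: "is_complex C V Q e"
    and f: "is_chain_map C P d Q e f" and g: "is_chain_map C Q e P d g"
  shows "is_chain_map C P d P d (\<lambda>n. diff_arr (g n \<cdot> f n) (Ident C (P n)))"
proof -
  have hP: "d (Suc n) \<in> homset C (P (Suc n)) (P n)" and hQ: "e (Suc n) \<in> homset C (Q (Suc n)) (Q n)"
    and obj: "P n \<in> Obj C" for n
    using P Q by (auto simp: is_complex_def augmented_seq_def)
  have hf: "f n \<in> homset C (P n) (Q n)" and ef: "e (Suc n) \<cdot> f (Suc n) = f n \<cdot> d (Suc n)" for n
    using f by (auto simp: is_chain_map_def)
  have hg: "g n \<in> homset C (Q n) (P n)" and dg: "d (Suc n) \<cdot> g (Suc n) = g n \<cdot> e (Suc n)" for n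
    using g by (auto simp: is_chain_map_def)
  note gf = Comp_homset[OF hg hf] and id = Ident_homset[OF obj]
  have "d (Suc n) \<cdot> (g (Suc n) \<cdot> f (Suc n)) = (g n \<cdot> f n) \<cdot> d (Suc n)" for n
    using Comp_assoc[OF hP hg hf] Comp_assoc[OF hg hQ hf] Comp_assoc[OF hg hf hP] dg ef by simp
  then show ?thesis
    using diff_homset[OF gf id] Comp_diff[OF hP gf id] diff_Comp[OF gf id hP] Comp_Ident[OF hP]
      Ident_Comp[OF hP]
    by (simp add: is_chain_map_def)
qed

text \<open>
  The chain map \<open>g \<cdot> f - id\<close> covers zero on \<open>V\<close>, hence has a null homotopy \<open>h\<close>. If the
  cocycle \<open>x\<close> has degree \<open>n + 1\<close>, then \<open>x \<cdot> h n \<cdot> d (n + 1)\<close> is the difference between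
  \<open>x \<cdot> g \<cdot> f\<close> and \<open>x\<close>, as the other half of the homotopy passes through
  \<open>x \<cdot> d (n + 2) = 0\<close>; in degree zero only that half is present.
\<close>

lemma chain_endomorphism_cohomology:
  assumes P: "is_complex C V P d" and Q: "is_complex C V Q e" and W: "W \<in> Obj C"
    and acyclic: "\<And>n. acyclic_against C (P n) V P d"
    and f: "is_chain_map C P d Q e f" "e 0 \<cdot> f 0 = d 0"
    and g: "is_chain_map C Q e P d g" "d 0 \<cdot> g 0 = e 0"
    and x: "x \<in> hom_cocycles P d W n"
  shows "\<exists>b\<in>coboundaries (hom_cochain C P d W) n. (x \<cdot> g n) \<cdot> f n = b \<otimes>\<^bsub>homgrp C (P n) W\<^esub> x"
proof -
  define w where "w n = diff_arr (g n \<cdot> f n) (Ident C (P n))" for n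
  have aP: "augmented_seq C V P d" using P by (auto simp: is_complex_def)
  note hP = augmented_seqD(1-5)[OF aP]
  have hf: "f n \<in> homset C (P n) (Q n)" and hg: "g n \<in> homset C (Q n) (P n)" for n
    using f g by (auto simp: is_chain_map_def)
  note gf = Comp_homset[OF hg hf] and id = Ident_homset[OF hP(2)]
  have w: "is_chain_map C P d P d w" using chain_map_comp_minus_id[OF P Q f(1) g(1)] unfolding w_def .
  have hw: "w n \<in> homset C (P n) (P n)" for n using diff_homset[OF gf id] by (simp add: w_def)
  have "d 0 \<cdot> w 0 = ZeroArr C (P 0) V"
    using Comp_diff[OF hP(3) gf id] Comp_assoc[OF hP(3) hg hf] f(2) g(2) Comp_Ident[OF hP(3)]
      diff_eq_Zero_iff[OF hP(3) hP(3)] by (simp add: w_def)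
  with null_homotopy_exists[OF P P acyclic w]
  obtain h where h: "\<And>n. h n \<in> homset C (P n) (P (Suc n))" "w 0 = d 1 \<cdot> h 0"
    "\<And>n. diff_arr (w (Suc n)) (h n \<cdot> d (Suc n)) = d (Suc (Suc n)) \<cdot> h (Suc n)"
    by blast
  have x': "x \<in> homset C (P n) W" and xd: "x \<cdot> d (Suc n) = ZeroArr C (P (Suc n)) W"
    using x by (auto simp: hom_cocycles_def)
  have xdh: "x \<cdot> (d (Suc n) \<cdot> h n) = ZeroArr C (P n) W"
    using Comp_assoc[OF x' hP(4) h(1)] xd Zero_Comp[OF h(1) W] by simp
  have "x \<cdot> w n \<in> coboundaries (hom_cochain C P d W) n"
  proof (cases n)
    case 0
    then show ?thesis using xdh h(2) by (simp add: mem_coboundaries_hom_cochain)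
  next
    case (Suc m)
    have hd: "h m \<cdot> d (Suc m) \<in> homset C (P (Suc m)) (P (Suc m))" using Comp_homset[OF h(1) hP(4)] .
    have xm: "x \<in> homset C (P (Suc m)) W" using x' Suc by simp
    have "diff_arr (x \<cdot> w (Suc m)) (x \<cdot> (h m \<cdot> d (Suc m))) = ZeroArr C (P (Suc m)) W"
      using Comp_diff[OF xm hw hd] h(3) xdh Suc by simp
    then have "x \<cdot> w (Suc m) = (x \<cdot> h m) \<cdot> d (Suc m)"
      using diff_eq_Zero_iff[OF Comp_homset[OF xm hw] Comp_homset[OF xm hd]] Comp_assoc[OF xm h(1) hP(4)]
      by simp
    then show ?thesis
      using Comp_homset[OF xm h(1)] Suc by (auto simp: mem_coboundaries_hom_cochain)
  qed
  moreover have "(x \<cdot> g n) \<cdot> f n = AddArr C (x \<cdot> w n) x"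
    using eq_diff_iff[OF Comp_homset[OF x' gf] x' Comp_homset[OF x' hw]] Comp_diff[OF x' gf id]
      Comp_Ident[OF x'] Comp_assoc[OF x' hg hf] by (simp add: w_def)
  ultimately show ?thesis by auto
qed

theorem comparison_cohomology_iso:
  assumes P: "is_complex C V P d" and Q: "is_complex C V Q e" and W: "W \<in> Obj C"
    and acyclic: "\<And>n. acyclic_against C (P n) V P d" "\<And>n. acyclic_against C (P n) V Q e"
      "\<And>n. acyclic_against C (Q n) V P d" "\<And>n. acyclic_against C (Q n) V Q e"
  shows "cohomology (hom_cochain C P d W) n \<cong> cohomology (hom_cochain C Q e W) n"
proof -
  obtain f where f: "is_chain_map C P d Q e f" "e 0 \<cdot> f 0 = d 0"
    using chain_map_exists[OF P Q acyclic(2)] .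
  obtain g where g: "is_chain_map C Q e P d g" "d 0 \<cdot> g 0 = e 0"
    using chain_map_exists[OF Q P acyclic(3)] .
  have obj: "P n \<in> Obj C" "Q n \<in> Obj C" and hg: "g n \<in> homset C (Q n) (P n)"
    using P Q g by (auto simp: is_complex_def augmented_seq_def is_chain_map_def)
  show ?thesis
    unfolding cohomology_hom_cochain
    by (rule subquotient_iso[where \<phi> = "\<lambda>x. x \<cdot> g n" and \<psi> = "\<lambda>y. y \<cdot> f n"])
      (fact homgrp_comm_group[OF obj(1) W] homgrp_comm_group[OF obj(2) W]
        subgroups_hom_cochain[OF P W] subgroups_hom_cochain[OF Q W] precompose_hom[OF hg W]
        precompose_chain_map[OF P Q W f(1)] precompose_chain_map[OF Q P W g(1)]
        chain_endomorphism_cohomology[OF P Q W acyclic(1) f g]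
        chain_endomorphism_cohomology[OF Q P W acyclic(4) g f])+
qed

end


section \<open>Exactness in abelian categories\<close>

context preadditive_category
begin

lemma is_kernelD:
  assumes "is_kernel C k g"
  shows "k \<in> homset C (Dom C k) (Dom C g)" "g \<in> homset C (Dom C g) (Cod C g)"
    "Dom C k \<in> Obj C" "g \<cdot> k = ZeroArr C (Dom C k) (Cod C g)"
  using assms Dom_Obj by (auto simp: is_kernel_def homset_def)

lemma kernel_factor:
  assumes "is_kernel C k g" "t \<in> homset C T (Dom C g)" "g \<cdot> t = ZeroArr C T (Cod C g)"
  obtains u where "u \<in> homset C T (Dom C k)" "k \<cdot> u = t"
  using assms unfolding is_kernel_def by blast

text \<open>
  A kernel is a mono: the two factorizations of \<open>k \<cdot> u\<close> through \<open>k\<close> must agree.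
\<close>

lemma kernel_cancel:
  assumes k: "is_kernel C k g" and u: "u \<in> homset C T (Dom C k)" "v \<in> homset C T (Dom C k)"
    and eq: "k \<cdot> u = k \<cdot> v"
  shows "u = v"
proof -
  note hk = is_kernelD[OF k]
  have "k \<cdot> u \<in> homset C T (Dom C g)" using Comp_homset hk(1) u(1) by blast
  moreover have "g \<cdot> (k \<cdot> u) = ZeroArr C T (Cod C g)"
    using Comp_assoc[OF hk(2,1) u(1)] hk(4) Zero_Comp[OF u(1)] homsetD(5)[OF hk(2)] by simp
  ultimately have "\<exists>!u'. u' \<in> homset C T (Dom C k) \<and> k \<cdot> u' = k \<cdot> u"
    using k unfolding is_kernel_def by blast
  then show ?thesis using u eq by metis
qed

lemma is_monoD:
  assumes "is_mono C m" "m \<in> homset C X Y" "u \<in> homset C T X" "v \<in> homset C T X" "m \<cdot> u = m \<cdot> v"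
  shows "u = v"
  using assms homsetD(2)[OF assms(2)] unfolding is_mono_def by blast

lemma is_epiD:
  assumes "is_epi C e" "e \<in> homset C X Y" "u \<in> homset C Y T" "v \<in> homset C Y T" "u \<cdot> e = v \<cdot> e"
  shows "u = v"
  using assms homsetD(3)[OF assms(2)] unfolding is_epi_def by blast

lemma kernel_is_mono: "is_kernel C k g \<Longrightarrow> is_mono C k"
  using kernel_cancel is_kernelD(1) homsetD(1) unfolding is_mono_def by blast

lemma Comp_is_mono:
  assumes "is_mono C m" "is_mono C n" "m \<in> homset C Y Z" "n \<in> homset C X Y"
  shows "is_mono C (m \<cdot> n)"
proof -
  have "u = v" if "u \<in> homset C T X" "v \<in> homset C T X" "(m \<cdot> n) \<cdot> u = (m \<cdot> n) \<cdot> v" for T u v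
    using that is_monoD[OF assms(1,3) Comp_homset[OF assms(4)] Comp_homset[OF assms(4)]]
      is_monoD[OF assms(2,4)] Comp_assoc[OF assms(3,4)] by metis
  then show ?thesis using homsetD[OF Comp_homset[OF assms(3,4)]] by (simp add: is_mono_def)
qed

lemma is_epi_cancel_left:
  assumes "is_epi C (k \<cdot> e)" "k \<in> homset C Y Z" "e \<in> homset C X Y"
  shows "is_epi C k"
proof -
  have "u = v" if "u \<in> homset C Z T" "v \<in> homset C Z T" "u \<cdot> k = v \<cdot> k" for T u v
    using that is_epiD[OF assms(1) Comp_homset[OF assms(2,3)]] Comp_assoc[OF _ assms(2,3)] by metis
  then show ?thesis using homsetD[OF assms(2)] by (simp add: is_epi_def)
qed

lemma Ident_is_epi: "X \<in> Obj C \<Longrightarrow> is_epi C (Ident C X)"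
  using homsetD[OF Ident_homset] Comp_Ident by (auto simp: is_epi_def)

lemma Ident_is_kernel_of_Zero:
  assumes "X \<in> Obj C" "Z \<in> Obj C"
  shows "is_kernel C (Ident C X) (ZeroArr C X Z)"
  using assms homsetD[OF Ident_homset] homsetD[OF Zero_homset[OF assms]] Ident_Comp Comp_Ident
    Zero_homset[OF assms]
  by (auto simp: is_kernel_def intro!: ex1I)

lemma Zero_is_kernel_of_mono:
  assumes m: "is_mono C m" "m \<in> homset C X Y" and Z: "is_zero_object C Z"
  shows "is_kernel C (ZeroArr C Z X) m"
proof -
  note hm = homsetD[OF m(2)]
  have ZObj: "Z \<in> Obj C" using Z by (simp add: is_zero_object_def)
  note h0 = Zero_homset[OF ZObj hm(4)]
  have "\<exists>!u. u \<in> homset C T Z \<and> ZeroArr C Z X \<cdot> u = t"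
    if t: "t \<in> homset C T X" "m \<cdot> t = ZeroArr C T Y" for T t
  proof -
    have T: "T \<in> Obj C" using homsetD[OF t(1)] by blast
    have "t = ZeroArr C T X"
      using is_monoD[OF m t(1) Zero_homset[OF T hm(4)]] t(2) Comp_Zero[OF m(2) T] by simp
    moreover have "\<exists>!u. u \<in> homset C T Z" using Z T by (auto simp: is_zero_object_def)
    ultimately show ?thesis using Zero_Comp hm(4) by metis
  qed
  then show ?thesis
    using hm homsetD[OF h0] Comp_Zero[OF m(2) ZObj] by (simp add: is_kernel_def)
qed

end

context abelian_category
begin

text \<open>
  Exactness in the form used from here on: the comparison map from \<open>f\<close> to the kernel of \<open>g\<close> is
  epi. The direction from left to right is where it matters that the category is abelian: an arrow
  factors through its image by an epi because every mono is a kernel. Conversely, an arrow and its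
  precomposition with an epi have the same cokernel, and the kernel \<open>k\<close> of \<open>g\<close> is then also a kernel of
  that cokernel \<open>c\<close>, since \<open>g\<close> factors through \<open>c\<close>.
\<close>

lemma exact_pair_iff:
  "exact_pair C f g \<longleftrightarrow> (\<exists>k e. is_kernel C k g \<and> is_epi C e \<and>
     e \<in> homset C (Dom C f) (Dom C k) \<and> f = k \<cdot> e)"
proof
  assume "exact_pair C f g"
  then obtain m c where fg: "f \<in> Arr C" "Cod C f = Dom C g"
    and c: "is_cokernel C c f" and mc: "is_kernel C m c" and mg: "is_kernel C m g"
    by (auto simp: exact_pair_def is_image_def)
  have hc: "Dom C c = Dom C g" and cf: "c \<cdot> f = ZeroArr C (Dom C f) (Cod C c)"
    using c fg by (auto simp: is_cokernel_def)
  note hm = is_kernelD(1)[OF mg]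
  have hf: "f \<in> homset C (Dom C f) (Dom C c)" using fg hc by (simp add: homset_def)
  obtain e where e: "e \<in> homset C (Dom C f) (Dom C m)" "m \<cdot> e = f"
    using kernel_factor[OF mc hf cf] .
  have "is_epi C e"
  proof (rule is_epi_if_cancels_Zero[OF e(1)])
    fix T t assume t: "t \<in> homset C (Dom C m) T" "t \<cdot> e = ZeroArr C (Dom C f) T"
    note ht = homsetD[OF t(1)]
    obtain n where n: "is_kernel C n t" using ex_kernel ht(1) by blast
    have hn: "n \<in> homset C (Dom C n) (Dom C m)" using is_kernelD(1)[OF n] ht by simp
    obtain e' where e': "e' \<in> homset C (Dom C f) (Dom C n)" "n \<cdot> e' = e"
      using kernel_factor[OF n] e(1) t(2) ht by metis
    \<comment> \<open>The mono \<open>m \<cdot> n\<close> is the kernel of some \<open>p\<close>; as \<open>p\<close> kills \<open>f\<close>, it factors through \<open>c\<close> and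
      thus kills the image \<open>m\<close>, so that \<open>n\<close>, the kernel of \<open>t\<close>, is split epi.\<close>
    obtain p where p: "is_kernel C (m \<cdot> n) p"
      using mono_is_kernel[OF Comp_is_mono[OF kernel_is_mono[OF mg] kernel_is_mono[OF n] hm hn]] by blast
    have hmn: "m \<cdot> n \<in> homset C (Dom C n) (Dom C g)" using Comp_homset[OF hm hn] .
    have dp: "Dom C p = Dom C g" using p homsetD(3)[OF hmn] by (simp add: is_kernel_def)
    have hp: "p \<in> homset C (Dom C g) (Cod C p)" using is_kernelD(2)[OF p] dp by simp
    have mne': "(m \<cdot> n) \<cdot> e' = f" using Comp_assoc[OF hm hn e'(1)] e'(2) e(2) by simp
    have "p \<cdot> f = ZeroArr C (Dom C f) (Cod C p)"
      using Comp_assoc[OF hp hmn e'(1)] mne' is_kernelD(4)[OF p] homsetD(2)[OF hmn]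
        Zero_Comp[OF e'(1)] homsetD(5)[OF hp] by simp
    then obtain p' where p': "p' \<in> homset C (Cod C c) (Cod C p)" "p' \<cdot> c = p"
      using c hp fg(2) unfolding is_cokernel_def by metis
    have hc': "c \<in> homset C (Dom C g) (Cod C c)" using is_kernelD(2)[OF mc] hc by simp
    have "p \<cdot> m = ZeroArr C (Dom C m) (Cod C p)"
      using Comp_assoc[OF p'(1) hc' hm] p'(2) is_kernelD(4)[OF mc] Comp_Zero[OF p'(1)] homsetD(4)[OF hm]
      by simp
    then obtain v where v: "v \<in> homset C (Dom C m) (Dom C n)" "(m \<cdot> n) \<cdot> v = m"
      using kernel_factor[OF p] hm dp homsetD(2)[OF hmn] by metis
    have "m \<cdot> (n \<cdot> v) = m \<cdot> Ident C (Dom C m)"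
      using Comp_assoc[OF hm hn v(1)] v(2) Comp_Ident[OF hm] by simp
    then have "n \<cdot> v = Ident C (Dom C m)"
      using kernel_cancel[OF mg Comp_homset[OF hn v(1)] Ident_homset[OF homsetD(4)[OF hm]]] by blast
    then have "t = (t \<cdot> n) \<cdot> v" using Comp_assoc[OF t(1) hn v(1)] Comp_Ident[OF t(1)] by simp
    then show "t = ZeroArr C (Dom C m) T"
      using is_kernelD(4)[OF n] ht Zero_Comp[OF v(1)] by simp
  qed
  then show "\<exists>k e. is_kernel C k g \<and> is_epi C e \<and> e \<in> homset C (Dom C f) (Dom C k) \<and> f = k \<cdot> e"
    using mg e by blast
next
  assume "\<exists>k e. is_kernel C k g \<and> is_epi C e \<and> e \<in> homset C (Dom C f) (Dom C k) \<and> f = k \<cdot> e"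
  then obtain k e where k: "is_kernel C k g" and e: "is_epi C e" "e \<in> homset C (Dom C f) (Dom C k)"
    and f: "f = k \<cdot> e" by blast
  note hk = is_kernelD[OF k]
  have hf: "f \<in> homset C (Dom C f) (Dom C g)" using Comp_homset[OF hk(1) e(2)] f by simp
  obtain c where c: "is_cokernel C c f" using ex_cokernel homsetD(1)[OF hf] by blast
  have hc: "c \<in> homset C (Dom C g) (Cod C c)" and cf: "c \<cdot> f = ZeroArr C (Dom C f) (Cod C c)"
    using c homsetD[OF hf] by (auto simp: is_cokernel_def homset_def)
  note Obj = homsetD(4)[OF hf] homsetD(5)[OF hc] homsetD(5)[OF hk(2)]
  have "(c \<cdot> k) \<cdot> e = ZeroArr C (Dom C k) (Cod C c) \<cdot> e"
    using Comp_assoc[OF hc hk(1) e(2)] f cf Zero_Comp[OF e(2) Obj(2)] by simp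
  then have ck: "c \<cdot> k = ZeroArr C (Dom C k) (Cod C c)"
    using is_epiD[OF e Comp_homset[OF hc hk(1)] Zero_homset] hk(3) Obj by blast
  have "g \<cdot> f = ZeroArr C (Dom C f) (Cod C g)"
    using Comp_assoc[OF hk(2,1) e(2)] f hk(4) Zero_Comp[OF e(2) Obj(3)] by simp
  then obtain g' where g': "g' \<in> homset C (Cod C c) (Cod C g)" "g' \<cdot> c = g"
    using c hk(2) homsetD(3)[OF hf] unfolding is_cokernel_def by metis
  have "\<exists>!u. u \<in> homset C T (Dom C k) \<and> k \<cdot> u = t"
    if t: "t \<in> homset C T (Dom C g)" "c \<cdot> t = ZeroArr C T (Cod C c)" for T t
  proof -
    have "g \<cdot> t = ZeroArr C T (Cod C g)"
      using Comp_assoc[OF g'(1) hc t(1)] g'(2) t(2) Comp_Zero[OF g'(1)] homsetD(4)[OF t(1)] by simp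
    then show ?thesis using k t(1) by (simp add: is_kernel_def)
  qed
  then have "is_kernel C k c"
    using ck homsetD[OF hk(1)] homsetD[OF hc] by (simp add: is_kernel_def)
  then show "exact_pair C f g"
    using c k homsetD[OF hf] homsetD(1)[OF hk(2)] by (auto simp: exact_pair_def is_image_def)
qed

lemma epi_exact_Zero:
  assumes f: "is_epi C f" "f \<in> homset C X Y" and Z: "Z \<in> Obj C"
  shows "exact_pair C f (ZeroArr C Y Z)"
  unfolding exact_pair_iff
  using Ident_is_kernel_of_Zero[OF homsetD(5)[OF f(2)] Z] f homsetD[OF f(2)] Ident_Comp[OF f(2)]
    homsetD(2)[OF Ident_homset[OF homsetD(5)[OF f(2)]]]
  by metis

text \<open>
  Preservation of short exact sequences says something about a single epi once it is completed by its
  kernel. Together with the next lemma, this is how an exact functor is seen to preserve epis.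
\<close>

lemma epi_short_exact:
  assumes f: "is_epi C f" and k: "is_kernel C k f"
  shows "short_exact C k f"
proof -
  obtain Z where Z: "is_zero_object C Z" using ex_zero_object by blast
  then have ZObj: "Z \<in> Obj C" by (simp add: is_zero_object_def)
  note hk = is_kernelD[OF k]
  note Obj = hk(3) homsetD(4,5)[OF hk(2)]
  have "exact_pair C (ZeroArr C Z (Dom C k)) k"
    unfolding exact_pair_iff
    using Zero_is_kernel_of_mono[OF kernel_is_mono[OF k] hk(1) Z] Ident_is_epi[OF ZObj]
      homsetD(2)[OF Zero_homset[OF ZObj Obj(1)]] Ident_homset[OF ZObj]
      Comp_Ident[OF Zero_homset[OF ZObj Obj(1)]]
    by (metis (no_types))
  moreover have "exact_pair C k f"
    unfolding exact_pair_iff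
    using k Ident_is_epi[OF Obj(1)] Ident_homset[OF Obj(1)] Comp_Ident[OF hk(1)]
    by metis
  moreover have "exact_pair C f (ZeroArr C (Cod C f) Z)"
    using epi_exact_Zero[OF f hk(2) ZObj] .
  ultimately show ?thesis using Z by (auto simp: short_exact_def)
qed

lemma epi_if_exact_Zero:
  assumes f: "exact_pair C f (ZeroArr C Y Z)" "f \<in> homset C X Y" and Z: "Z \<in> Obj C"
  shows "is_epi C f"
proof -
  note Y = homsetD(5)[OF f(2)]
  note h0 = Zero_homset[OF Y Z]
  obtain k e where k: "is_kernel C k (ZeroArr C Y Z)" and e: "is_epi C e"
    "e \<in> homset C X (Dom C k)" "f = k \<cdot> e"
    using f(1) homsetD(2)[OF f(2)] unfolding exact_pair_iff by metis
  have hk: "k \<in> homset C (Dom C k) Y" using is_kernelD(1)[OF k] homsetD(2)[OF h0] by simp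
  \<comment> \<open>A kernel of a zero arrow is split epi, since the identity factors through it.\<close>
  obtain r where r: "r \<in> homset C Y (Dom C k)" "k \<cdot> r = Ident C Y"
    using kernel_factor[OF k, of "Ident C Y" Y] Ident_homset[OF Y] homsetD(2,3)[OF h0] Comp_Ident[OF h0]
    by metis
  have "u = v" if uv: "u \<in> homset C Y T" "v \<in> homset C Y T" "u \<cdot> f = v \<cdot> f" for T u v
  proof -
    have "(u \<cdot> k) \<cdot> e = (v \<cdot> k) \<cdot> e"
      using uv e(3) Comp_assoc[OF uv(1) hk e(2)] Comp_assoc[OF uv(2) hk e(2)] by simp
    then have "u \<cdot> k = v \<cdot> k"
      using is_epiD[OF e(1,2)] Comp_homset[OF _ hk] uv by blast
    then have "u \<cdot> (k \<cdot> r) = v \<cdot> (k \<cdot> r)"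
      using Comp_assoc[OF uv(1) hk r(1)] Comp_assoc[OF uv(2) hk r(1)] by simp
    then show ?thesis using r(2) Comp_Ident uv by simp
  qed
  then show ?thesis using homsetD[OF f(2)] by (simp add: is_epi_def)
qed

end


section \<open>Resolvent pairs\<close>

lemma is_functorD:
  assumes "is_functor C D T"
  shows "X \<in> Obj C \<Longrightarrow> omap T X \<in> Obj D"
    "f \<in> homset C X Y \<Longrightarrow> amap T f \<in> homset D (omap T X) (omap T Y)"
    "g \<in> homset C Y Z \<Longrightarrow> f \<in> homset C X Y \<Longrightarrow> amap T (g \<cdot>\<^bsub>C\<^esub> f) = amap T g \<cdot>\<^bsub>D\<^esub> amap T f"
  using assms by (auto simp: is_functor_def)

locale resolvent_pair = A: abelian_category A + B: abelian_category B
  for A :: "('o, 'm) cat" and B :: "('p, 'q) cat" +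
  fixes U :: "('o, 'm, 'p, 'q) cat_functor" and F :: "('p, 'q, 'o, 'm) cat_functor"
    and \<eta> :: "'p \<Rightarrow> 'q" and \<epsilon> :: "'o \<Rightarrow> 'm"
  assumes U_additive: "is_additive_functor A B U"
    and U_exact: "is_exact_functor A B U"
    and U_faithful: "is_faithful_functor A B U"
    and adjunction: "is_adjunction A B F U \<eta> \<epsilon>"
begin

abbreviation G :: "('o, 'm) comonad" where "G \<equiv> adjunction_comonad F U \<eta> \<epsilon>"

lemma G_simps [simp]:
  "omap (cfunctor G) = omap F \<circ> omap U" "amap (cfunctor G) = amap F \<circ> amap U" "counit G = \<epsilon>"
  by (simp_all add: adjunction_comonad_def comp_functor_def)

lemma is_functor_U: "is_functor A B U"
  using U_additive by (simp add: is_additive_functor_def)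

lemma is_functor_F: "is_functor B A F"
  using adjunction by (simp add: is_adjunction_def)

lemmas U_Obj = is_functorD(1)[OF is_functor_U] and U_homset = is_functorD(2)[OF is_functor_U]
  and U_Comp = is_functorD(3)[OF is_functor_U]
lemmas F_Obj = is_functorD(1)[OF is_functor_F] and F_homset = is_functorD(2)[OF is_functor_F]
  and F_Comp = is_functorD(3)[OF is_functor_F]

lemma U_Zero:
  assumes "X \<in> Obj A" "Y \<in> Obj A"
  shows "amap U (ZeroArr A X Y) = ZeroArr B (omap U X) (omap U Y)"
proof -
  have "amap U \<in> hom (homgrp A X Y) (homgrp B (omap U X) (omap U Y))"
    using U_additive assms by (simp add: is_additive_functor_def)
  from hom_one[OF this A.homgrp_group B.homgrp_group] show ?thesis using assms U_Obj by simp
qed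

lemma eps_homset: "V \<in> Obj A \<Longrightarrow> \<epsilon> V \<in> homset A (omap F (omap U V)) V"
  and eps_natural: "f \<in> homset A X Y \<Longrightarrow> \<epsilon> Y \<cdot>\<^bsub>A\<^esub> amap F (amap U f) = f \<cdot>\<^bsub>A\<^esub> \<epsilon> X"
  and eta_homset: "T \<in> Obj B \<Longrightarrow> \<eta> T \<in> homset B T (omap U (omap F T))"
  and eta_natural: "t \<in> homset B S T \<Longrightarrow> \<eta> T \<cdot>\<^bsub>B\<^esub> t = amap U (amap F t) \<cdot>\<^bsub>B\<^esub> \<eta> S"
  and triangle_F: "T \<in> Obj B \<Longrightarrow> \<epsilon> (omap F T) \<cdot>\<^bsub>A\<^esub> amap F (\<eta> T) = Ident A (omap F T)"
  and triangle_U: "V \<in> Obj A \<Longrightarrow> amap U (\<epsilon> V) \<cdot>\<^bsub>B\<^esub> \<eta> (omap U V) = Ident B (omap U V)"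
  using adjunction by (auto simp: is_adjunction_def is_natural_def comp_functor_def id_functor_def)

text \<open>
  The arrow \<open>F T \<rightarrow> Y\<close> that corresponds to \<open>t : T \<rightarrow> U Y\<close>. Lifts are transported
  along this bijection, its inverse \<open>x \<mapsto> U x \<cdot> \<eta> T\<close> and its naturality in \<open>Y\<close>.
\<close>

definition adjunct :: "'o \<Rightarrow> 'q \<Rightarrow> 'm" where
  "adjunct Y t = \<epsilon> Y \<cdot>\<^bsub>A\<^esub> amap F t"

lemma adjunct_homset:
  assumes "t \<in> homset B T (omap U Y)" "Y \<in> Obj A"
  shows "adjunct Y t \<in> homset A (omap F T) Y"
  unfolding adjunct_def using A.Comp_homset[OF eps_homset F_homset] assms by blast

lemma U_adjunct:
  assumes t: "t \<in> homset B T (omap U Y)" and Y: "Y \<in> Obj A"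
  shows "amap U (adjunct Y t) \<cdot>\<^bsub>B\<^esub> \<eta> T = t"
proof -
  note hU = U_homset[OF eps_homset[OF Y]] U_homset[OF F_homset[OF t]]
  note T = B.homsetD(4)[OF t]
  have "amap U (adjunct Y t) \<cdot>\<^bsub>B\<^esub> \<eta> T = amap U (\<epsilon> Y) \<cdot>\<^bsub>B\<^esub> (amap U (amap F t) \<cdot>\<^bsub>B\<^esub> \<eta> T)"
    unfolding adjunct_def
    using U_Comp[OF eps_homset[OF Y] F_homset[OF t]] B.Comp_assoc[OF hU eta_homset[OF T]] by simp
  also have "\<dots> = (amap U (\<epsilon> Y) \<cdot>\<^bsub>B\<^esub> \<eta> (omap U Y)) \<cdot>\<^bsub>B\<^esub> t"
    using eta_natural[OF t] B.Comp_assoc[OF hU(1) eta_homset[OF U_Obj[OF Y]] t] by simp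
  also have "\<dots> = t" using triangle_U[OF Y] B.Ident_Comp[OF t] by simp
  finally show ?thesis .
qed

lemma adjunct_U:
  assumes x: "x \<in> homset A (omap F T) Y" and T: "T \<in> Obj B"
  shows "adjunct Y (amap U x \<cdot>\<^bsub>B\<^esub> \<eta> T) = x"
proof -
  note Y = A.homsetD(5)[OF x]
  note hF = F_homset[OF U_homset[OF x]] F_homset[OF eta_homset[OF T]]
  have "adjunct Y (amap U x \<cdot>\<^bsub>B\<^esub> \<eta> T) = (\<epsilon> Y \<cdot>\<^bsub>A\<^esub> amap F (amap U x)) \<cdot>\<^bsub>A\<^esub> amap F (\<eta> T)"
    unfolding adjunct_def
    using F_Comp[OF U_homset[OF x] eta_homset[OF T]] A.Comp_assoc[OF eps_homset[OF Y] hF] by simp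
  also have "\<dots> = x \<cdot>\<^bsub>A\<^esub> (\<epsilon> (omap F T) \<cdot>\<^bsub>A\<^esub> amap F (\<eta> T))"
    using eps_natural[OF x] A.Comp_assoc[OF x eps_homset[OF F_Obj[OF T]] hF(2)] by simp
  also have "\<dots> = x" using triangle_F[OF T] A.Comp_Ident[OF x] by simp
  finally show ?thesis .
qed

lemma Comp_adjunct:
  assumes f: "f \<in> homset A Y Z" and t: "t \<in> homset B T (omap U Y)"
  shows "f \<cdot>\<^bsub>A\<^esub> adjunct Y t = adjunct Z (amap U f \<cdot>\<^bsub>B\<^esub> t)"
  unfolding adjunct_def
  using A.Comp_assoc[OF f eps_homset F_homset[OF t]] eps_natural[OF f]
    F_Comp[OF U_homset[OF f] t] A.Comp_assoc[OF eps_homset F_homset[OF U_homset[OF f]] F_homset[OF t]]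
    A.homsetD(4,5)[OF f]
  by simp

lemma adjunct_Zero:
  assumes "T \<in> Obj B" "Y \<in> Obj A"
  shows "adjunct Y (ZeroArr B T (omap U Y)) = ZeroArr A (omap F T) Y"
  using adjunct_U[OF A.Zero_homset[OF F_Obj] assms(1)] U_Zero[OF F_Obj]
    B.Zero_Comp[OF eta_homset U_Obj] assms by simp

text \<open>
  A right adjoint preserves kernels: transpose the problem to \<open>A\<close>, factor there, and
  transpose back.
\<close>

lemma U_kernel_factor:
  assumes k: "is_kernel A k g" and t: "t \<in> homset B T (omap U (Dom A g))"
    and gt: "amap U g \<cdot>\<^bsub>B\<^esub> t = ZeroArr B T (omap U (Cod A g))"
  obtains u where "u \<in> homset B T (omap U (Dom A k))" "amap U k \<cdot>\<^bsub>B\<^esub> u = t"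
proof -
  note hk = A.is_kernelD[OF k]
  note Obj = A.homsetD(4,5)[OF hk(2)] B.homsetD(4)[OF t]
  have "g \<cdot>\<^bsub>A\<^esub> adjunct (Dom A g) t = ZeroArr A (omap F T) (Cod A g)"
    using Comp_adjunct[OF hk(2) t] gt adjunct_Zero Obj by simp
  then obtain y where y: "y \<in> homset A (omap F T) (Dom A k)" "k \<cdot>\<^bsub>A\<^esub> y = adjunct (Dom A g) t"
    using A.kernel_factor[OF k adjunct_homset[OF t Obj(1)]] by blast
  have "amap U k \<cdot>\<^bsub>B\<^esub> (amap U y \<cdot>\<^bsub>B\<^esub> \<eta> T) = t"
    using B.Comp_assoc[OF U_homset[OF hk(1)] U_homset[OF y(1)] eta_homset[OF Obj(3)]]
      U_Comp[OF hk(1) y(1)] y(2) U_adjunct[OF t Obj(1)] by simp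
  then show thesis using that B.Comp_homset[OF U_homset[OF y(1)] eta_homset[OF Obj(3)]] by blast
qed

lemma U_epi:
  assumes f: "is_epi A f" "f \<in> homset A X Y"
  shows "is_epi B (amap U f)"
proof -
  obtain k where k: "is_kernel A k f" using A.ex_kernel A.homsetD(1)[OF f(2)] by blast
  have "short_exact B (amap U k) (amap U f)"
    using U_exact A.epi_short_exact[OF f(1) k] by (simp add: is_exact_functor_def)
  then obtain Z where "is_zero_object B Z" "exact_pair B (amap U f) (ZeroArr B (omap U Y) Z)"
    using B.homsetD(3)[OF U_homset[OF f(2)]] by (auto simp: short_exact_def)
  then show ?thesis
    using B.epi_if_exact_Zero[OF _ U_homset[OF f(2)]] by (simp add: is_zero_object_def)
qed

text \<open>
  By the triangle identity \<open>U (\<epsilon> V)\<close> is split epi, and a faithful functor reflects epis.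
\<close>

lemma eps_epi:
  assumes V: "V \<in> Obj A"
  shows "is_epi A (\<epsilon> V)"
proof -
  note he = eps_homset[OF V] and hn = eta_homset[OF U_Obj[OF V]]
  have U_retract: "amap U (u \<cdot>\<^bsub>A\<^esub> \<epsilon> V) \<cdot>\<^bsub>B\<^esub> \<eta> (omap U V) = amap U u" if u: "u \<in> homset A V T" for u T
    using U_Comp[OF u he] B.Comp_assoc[OF U_homset[OF u] U_homset[OF he] hn] triangle_U[OF V]
      B.Comp_Ident[OF U_homset[OF u]] by simp
  have "u = v" if uv: "u \<in> homset A V T" "v \<in> homset A V T" "u \<cdot>\<^bsub>A\<^esub> \<epsilon> V = v \<cdot>\<^bsub>A\<^esub> \<epsilon> V" for u v T
  proof -
    have "amap U u = amap U v" using U_retract uv by metis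
    moreover have "inj_on (amap U) (homset A V T)"
      using U_faithful V A.homsetD(5)[OF uv(1)] by (simp add: is_faithful_functor_def)
    ultimately show ?thesis using uv by (simp add: inj_on_eq_iff)
  qed
  then show ?thesis using A.homsetD[OF he] by (simp add: is_epi_def)
qed

text \<open>
  The unit is the splitting that allowability asks for, again by the triangle identity.
\<close>

lemma eps_allowable:
  assumes V: "V \<in> Obj A"
  shows "allowable A B U (\<epsilon> V)"
proof -
  note he = eps_homset[OF V] and hn = eta_homset[OF U_Obj[OF V]]
  have "amap U (\<epsilon> V) \<cdot>\<^bsub>B\<^esub> \<eta> (omap U V) \<cdot>\<^bsub>B\<^esub> amap U (\<epsilon> V) = amap U (\<epsilon> V)"
    using B.Comp_assoc[OF U_homset[OF he] hn U_homset[OF he]] triangle_U[OF V]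
      B.Ident_Comp[OF U_homset[OF he]] by simp
  then show ?thesis using A.homsetD[OF he] hn by (auto simp: allowable_def)
qed

text \<open>
  Both the lifting of arrows along allowable epis and the \<open>G\<close>-exactness of allowable exact sequences
  are instances of this. Since \<open>U e\<close> is
  epi, it can be cancelled in \<open>U f \<cdot> s \<cdot> U f = U f\<close> for \<open>f = k \<cdot> e\<close>, which leaves
  \<open>U f \<cdot> s \<cdot> U k = U k\<close>. So over \<open>B\<close> every arrow that factors through \<open>U k\<close> lifts along \<open>U f\<close>, and
  the adjunction carries the lift to arrows out of \<open>F T\<close>. With \<open>k = id\<close> this is the lifting along
  allowable epis; with \<open>k\<close> a kernel it is exactness under \<open>Hom(F T, -)\<close>.
\<close>

lemma allowable_lift:
  assumes f: "allowable A B U (k \<cdot>\<^bsub>A\<^esub> e)" and e: "is_epi A e" "e \<in> homset A X K"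
    and k: "k \<in> homset A K Y" and T: "T \<in> Obj B" and y: "y \<in> homset A (omap F T) K"
  obtains h where "h \<in> homset A (omap F T) X" "(k \<cdot>\<^bsub>A\<^esub> e) \<cdot>\<^bsub>A\<^esub> h = k \<cdot>\<^bsub>A\<^esub> y"
proof -
  note hf = A.Comp_homset[OF k e(2)]
  note Obj = A.homsetD(4,5)[OF hf] A.homsetD(4)[OF k]
  let ?f = "amap U (k \<cdot>\<^bsub>A\<^esub> e)" and ?e = "amap U e" and ?k = "amap U k"
  obtain s where s: "s \<in> homset B (omap U Y) (omap U X)" "?f \<cdot>\<^bsub>B\<^esub> s \<cdot>\<^bsub>B\<^esub> ?f = ?f"
    using f A.homsetD(2,3)[OF hf] by (auto simp: allowable_def)
  note Uf = U_homset[OF hf] and Ue = U_homset[OF e(2)] and Uk = U_homset[OF k]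
  note fs = B.Comp_homset[OF Uf s(1)]
  have f_eq: "?f = ?k \<cdot>\<^bsub>B\<^esub> ?e" using U_Comp[OF k e(2)] .
  have "((?f \<cdot>\<^bsub>B\<^esub> s) \<cdot>\<^bsub>B\<^esub> ?k) \<cdot>\<^bsub>B\<^esub> ?e = ?f \<cdot>\<^bsub>B\<^esub> s \<cdot>\<^bsub>B\<^esub> ?f"
    using B.Comp_assoc[OF fs Uk Ue] B.Comp_assoc[OF Uf s(1) Uf] f_eq by simp
  then have fsk: "(?f \<cdot>\<^bsub>B\<^esub> s) \<cdot>\<^bsub>B\<^esub> ?k = ?k"
    using B.is_epiD[OF U_epi[OF e] Ue B.Comp_homset[OF fs Uk] Uk] s(2) f_eq by simp
  let ?y = "amap U y \<cdot>\<^bsub>B\<^esub> \<eta> T"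
  note Uy = B.Comp_homset[OF U_homset[OF y] eta_homset[OF T]]
  note sky = B.Comp_homset[OF s(1) B.Comp_homset[OF Uk Uy]]
  have "(k \<cdot>\<^bsub>A\<^esub> e) \<cdot>\<^bsub>A\<^esub> adjunct X (s \<cdot>\<^bsub>B\<^esub> ?k \<cdot>\<^bsub>B\<^esub> ?y) = adjunct Y (?f \<cdot>\<^bsub>B\<^esub> s \<cdot>\<^bsub>B\<^esub> ?k \<cdot>\<^bsub>B\<^esub> ?y)"
    using Comp_adjunct[OF hf sky] .
  also have "?f \<cdot>\<^bsub>B\<^esub> s \<cdot>\<^bsub>B\<^esub> ?k \<cdot>\<^bsub>B\<^esub> ?y = ((?f \<cdot>\<^bsub>B\<^esub> s) \<cdot>\<^bsub>B\<^esub> ?k) \<cdot>\<^bsub>B\<^esub> ?y"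
    using B.Comp_assoc[OF Uf s(1) B.Comp_homset[OF Uk Uy]] B.Comp_assoc[OF fs Uk Uy] by simp
  also have "adjunct Y \<dots> = k \<cdot>\<^bsub>A\<^esub> adjunct K ?y"
    using fsk Comp_adjunct[OF k Uy] by simp
  also have "adjunct K ?y = y" using adjunct_U[OF y T] .
  finally show thesis using that adjunct_homset[OF sky Obj(1)] by blast
qed


section \<open>Relatively projective objects are the \<open>G\<close>-projective ones\<close>

lemma G_projective_F:
  assumes T: "T \<in> Obj B"
  shows "G_projective A G (omap F T)"
  using F_Obj[OF T] F_homset[OF eta_homset[OF T]] triangle_F[OF T] by (auto simp: G_projective_def)

text \<open>
  Lift \<open>g \<cdot> \<epsilon> P\<close> along \<open>f\<close>, and restrict the lift along the section of \<open>\<epsilon> P\<close>.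
\<close>

lemma G_projective_imp_relatively_projective:
  assumes "G_projective A G P"
  shows "relatively_projective A B U P"
proof -
  have P: "P \<in> Obj A" using assms by (simp add: G_projective_def)
  obtain s where s: "s \<in> homset A P (omap F (omap U P))" "\<epsilon> P \<cdot>\<^bsub>A\<^esub> s = Ident A P"
    using assms by (auto simp: G_projective_def)
  note he = eps_homset[OF P]
  have "\<exists>h\<in>homset A P V. f \<cdot>\<^bsub>A\<^esub> h = g"
    if f: "f \<in> homset A V W" "allowable A B U f" "is_epi A f" and g: "g \<in> homset A P W" for V W f g
  proof -
    note id = A.Ident_homset[OF A.homsetD(5)[OF f(1)]]
    note ge = A.Comp_homset[OF g he]
    obtain h where h: "h \<in> homset A (omap F (omap U P)) V" "f \<cdot>\<^bsub>A\<^esub> h = g \<cdot>\<^bsub>A\<^esub> \<epsilon> P"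
      using allowable_lift[OF _ f(3,1) id U_Obj[OF P] ge] f(2) A.Ident_Comp[OF f(1)] A.Ident_Comp[OF ge]
      by metis
    have "f \<cdot>\<^bsub>A\<^esub> (h \<cdot>\<^bsub>A\<^esub> s) = g"
      using A.Comp_assoc[OF f(1) h(1) s(1)] h(2) A.Comp_assoc[OF g he s(1)] s(2) A.Comp_Ident[OF g]
      by simp
    then show ?thesis using A.Comp_homset[OF h(1) s(1)] by blast
  qed
  then show ?thesis using P by (simp add: relatively_projective_def)
qed

text \<open>
  For the converse, the identity of \<open>P\<close> lifts along \<open>\<epsilon> P\<close>, which is itself an allowable epi.
\<close>

theorem G_projective_iff_relatively_projective:
  "G_projective A G P \<longleftrightarrow> relatively_projective A B U P"
proof
  assume R: "relatively_projective A B U P"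
  then have P: "P \<in> Obj A" by (simp add: relatively_projective_def)
  have "\<exists>h\<in>homset A P (omap F (omap U P)). \<epsilon> P \<cdot>\<^bsub>A\<^esub> h = Ident A P"
    using R eps_homset[OF P] eps_allowable[OF P] eps_epi[OF P] A.Ident_homset[OF P]
    unfolding relatively_projective_def by blast
  then show "G_projective A G P" using P by (simp add: G_projective_def)
qed (rule G_projective_imp_relatively_projective)


section \<open>Relatively projective resolutions are the \<open>G\<close>-resolutions\<close>

lemma G_exact_iff:
  "G_exact A G f g \<longleftrightarrow> f \<in> Arr A \<and> g \<in> Arr A \<and> Cod A f = Dom A g \<and>
     g \<cdot>\<^bsub>A\<^esub> f = ZeroArr A (Dom A f) (Cod A g) \<and>
     (\<forall>V\<in>Obj A. \<forall>x\<in>homset A (omap F (omap U V)) (Dom A g).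
        g \<cdot>\<^bsub>A\<^esub> x = ZeroArr A (omap F (omap U V)) (Cod A g) \<longrightarrow>
        (\<exists>y\<in>homset A (omap F (omap U V)) (Dom A f). f \<cdot>\<^bsub>A\<^esub> y = x))"
proof -
  have "exact_seq ([homgrp A T (Cod A g), homgrp A T (Dom A g), homgrp A T (Dom A f)],
          [\<lambda>h. g \<cdot>\<^bsub>A\<^esub> h, \<lambda>h. f \<cdot>\<^bsub>A\<^esub> h]) \<longleftrightarrow>
        (\<forall>x\<in>homset A T (Dom A g). g \<cdot>\<^bsub>A\<^esub> x = ZeroArr A T (Cod A g) \<longrightarrow>
          (\<exists>y\<in>homset A T (Dom A f). f \<cdot>\<^bsub>A\<^esub> y = x))"
    if T: "T \<in> Obj A" and f: "f \<in> homset A (Dom A f) (Dom A g)" and g: "g \<in> homset A (Dom A g) (Cod A g)"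
      and gf: "g \<cdot>\<^bsub>A\<^esub> f = ZeroArr A (Dom A f) (Cod A g)" for T
  proof -
    have grp: "group (homgrp A T (Dom A f))" "group (homgrp A T (Dom A g))" "group (homgrp A T (Cod A g))"
      using A.homgrp_group T A.homsetD[OF f] A.homsetD[OF g] by auto
    have "g \<cdot>\<^bsub>A\<^esub> (f \<cdot>\<^bsub>A\<^esub> y) = ZeroArr A T (Cod A g)" "f \<cdot>\<^bsub>A\<^esub> y \<in> homset A T (Dom A g)"
      if "y \<in> homset A T (Dom A f)" for y
      using A.Comp_assoc[OF g f that] gf A.Zero_Comp[OF that] A.homsetD[OF g] A.Comp_homset[OF f that]
      by auto
    note comp = this
    have "exact_seq ([homgrp A T (Cod A g), homgrp A T (Dom A g), homgrp A T (Dom A f)],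
          [\<lambda>h. g \<cdot>\<^bsub>A\<^esub> h, \<lambda>h. f \<cdot>\<^bsub>A\<^esub> h]) \<longleftrightarrow>
        {x \<in> homset A T (Dom A g). g \<cdot>\<^bsub>A\<^esub> x = ZeroArr A T (Cod A g)} =
          (\<lambda>y. f \<cdot>\<^bsub>A\<^esub> y) ` homset A T (Dom A f)"
      using grp A.postcompose_hom[OF f T] A.postcompose_hom[OF g T]
      by (simp add: group_hom_def group_hom_axioms_def kernel_def)
    also have "\<dots> \<longleftrightarrow> (\<forall>x\<in>homset A T (Dom A g). g \<cdot>\<^bsub>A\<^esub> x = ZeroArr A T (Cod A g) \<longrightarrow>
          (\<exists>y\<in>homset A T (Dom A f). f \<cdot>\<^bsub>A\<^esub> y = x))"
      unfolding set_eq_iff image_iff mem_Collect_eq using comp by metis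
    finally show ?thesis .
  qed
  then show ?thesis
    unfolding G_exact_def Let_def
    using F_Obj[OF U_Obj] A.Arr_homset[of f] A.Arr_homset[of g]
    by (auto simp del: exact_seq_cons_iff)
qed

text \<open>
  Exactness against the objects \<open>G V\<close> passes to their retracts.
\<close>

lemma G_exact_lift:
  assumes fg: "G_exact A G f g" and P: "G_projective A G P"
    and x: "x \<in> homset A P (Dom A g)" "g \<cdot>\<^bsub>A\<^esub> x = ZeroArr A P (Cod A g)"
  shows "\<exists>y\<in>homset A P (Dom A f). f \<cdot>\<^bsub>A\<^esub> y = x"
proof -
  have PObj: "P \<in> Obj A" using P by (simp add: G_projective_def)
  obtain s where s: "s \<in> homset A P (omap F (omap U P))" "\<epsilon> P \<cdot>\<^bsub>A\<^esub> s = Ident A P"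
    using P by (auto simp: G_projective_def)
  note he = eps_homset[OF PObj]
  have hf: "f \<in> homset A (Dom A f) (Dom A g)" and hg: "g \<in> homset A (Dom A g) (Cod A g)"
    using fg by (auto simp: G_exact_iff homset_def)
  have "g \<cdot>\<^bsub>A\<^esub> (x \<cdot>\<^bsub>A\<^esub> \<epsilon> P) = ZeroArr A (omap F (omap U P)) (Cod A g)"
    using A.Comp_assoc[OF hg x(1) he] x(2) A.Zero_Comp[OF he] A.homsetD(5)[OF hg] by simp
  then obtain y where y: "y \<in> homset A (omap F (omap U P)) (Dom A f)" "f \<cdot>\<^bsub>A\<^esub> y = x \<cdot>\<^bsub>A\<^esub> \<epsilon> P"
    using fg PObj A.Comp_homset[OF x(1) he] unfolding G_exact_iff by blast
  have "f \<cdot>\<^bsub>A\<^esub> (y \<cdot>\<^bsub>A\<^esub> s) = x"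
    using A.Comp_assoc[OF hf y(1) s(1)] y(2) A.Comp_assoc[OF x(1) he s(1)] s(2) A.Comp_Ident[OF x(1)]
    by simp
  then show ?thesis using A.Comp_homset[OF y(1) s(1)] by blast
qed

lemma exact_allowable_imp_G_exact:
  assumes fg: "exact_pair A f g" and f: "allowable A B U f"
  shows "G_exact A G f g"
proof -
  obtain k e where k: "is_kernel A k g" and e: "is_epi A e" "e \<in> homset A (Dom A f) (Dom A k)"
    and f_eq: "f = k \<cdot>\<^bsub>A\<^esub> e"
    using fg by (auto simp: A.exact_pair_iff)
  note hk = A.is_kernelD[OF k]
  have "\<exists>y\<in>homset A (omap F (omap U V)) (Dom A f). f \<cdot>\<^bsub>A\<^esub> y = x"
    if V: "V \<in> Obj A" and x: "x \<in> homset A (omap F (omap U V)) (Dom A g)"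
      and gx: "g \<cdot>\<^bsub>A\<^esub> x = ZeroArr A (omap F (omap U V)) (Cod A g)" for V x
  proof -
    obtain y where y: "y \<in> homset A (omap F (omap U V)) (Dom A k)" "k \<cdot>\<^bsub>A\<^esub> y = x"
      using A.kernel_factor[OF k x gx] .
    show ?thesis
      using allowable_lift[OF _ e hk(1) U_Obj[OF V] y(1)] f y(2) unfolding f_eq[symmetric] by metis
  qed
  moreover have "g \<cdot>\<^bsub>A\<^esub> f = ZeroArr A (Dom A f) (Cod A g)"
    using A.Comp_assoc[OF hk(2,1) e(2)] f_eq hk(4) A.Zero_Comp[OF e(2)] A.homsetD(5)[OF hk(2)] by simp
  ultimately show ?thesis using fg by (auto simp: G_exact_iff exact_pair_def)
qed

text \<open>
  The key to the passage from \<open>G\<close>-exactness back to ordinary exactness: test it on the arrow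
  \<open>k \<cdot> \<epsilon> K\<close> out of \<open>G K\<close>, where \<open>K\<close> is the kernel of \<open>g\<close>. It lifts along \<open>f\<close>, and so the
  counit of \<open>K\<close> factors through the comparison map \<open>e\<close> from \<open>f\<close> to the kernel.
\<close>

lemma G_exact_kernel_cover:
  assumes fg: "G_exact A G f g" and k: "is_kernel A k g"
  obtains e h where "e \<in> homset A (Dom A f) (Dom A k)" "f = k \<cdot>\<^bsub>A\<^esub> e"
    "h \<in> homset A (omap F (omap U (Dom A k))) (Dom A f)" "e \<cdot>\<^bsub>A\<^esub> h = \<epsilon> (Dom A k)"
proof -
  have hf: "f \<in> homset A (Dom A f) (Dom A g)" and gf: "g \<cdot>\<^bsub>A\<^esub> f = ZeroArr A (Dom A f) (Cod A g)"
    using fg by (auto simp: G_exact_iff homset_def)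
  note hk = A.is_kernelD[OF k]
  note he = eps_homset[OF hk(3)]
  obtain e where e: "e \<in> homset A (Dom A f) (Dom A k)" "k \<cdot>\<^bsub>A\<^esub> e = f"
    using A.kernel_factor[OF k hf gf] .
  have "g \<cdot>\<^bsub>A\<^esub> (k \<cdot>\<^bsub>A\<^esub> \<epsilon> (Dom A k)) = ZeroArr A (omap F (omap U (Dom A k))) (Cod A g)"
    using A.Comp_assoc[OF hk(2,1) he] hk(4) A.Zero_Comp[OF he] A.homsetD(5)[OF hk(2)] by simp
  then obtain h where h: "h \<in> homset A (omap F (omap U (Dom A k))) (Dom A f)"
    "f \<cdot>\<^bsub>A\<^esub> h = k \<cdot>\<^bsub>A\<^esub> \<epsilon> (Dom A k)"
    using fg hk(3) A.Comp_homset[OF hk(1) he] unfolding G_exact_iff by blast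
  have "e \<cdot>\<^bsub>A\<^esub> h = \<epsilon> (Dom A k)"
    using A.kernel_cancel[OF k A.Comp_homset[OF e(1) h(1)] he] A.Comp_assoc[OF hk(1) e(1) h(1)] e(2) h(2)
    by simp
  then show thesis using that e h by blast
qed

text \<open>
  The comparison map to the kernel is epi, because the counit factors through it.
\<close>

lemma G_exact_imp_exact:
  assumes fg: "G_exact A G f g"
  shows "exact_pair A f g"
proof -
  have "g \<in> Arr A" using fg by (simp add: G_exact_iff)
  then obtain k where k: "is_kernel A k g" using A.ex_kernel by blast
  from G_exact_kernel_cover[OF fg k] obtain e h where
    e: "e \<in> homset A (Dom A f) (Dom A k)" "f = k \<cdot>\<^bsub>A\<^esub> e"
    and h: "h \<in> homset A (omap F (omap U (Dom A k))) (Dom A f)" "e \<cdot>\<^bsub>A\<^esub> h = \<epsilon> (Dom A k)" .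
  have "is_epi A e"
    using A.is_epi_cancel_left[OF _ e(1) h(1)] h(2) eps_epi[OF A.is_kernelD(3)[OF k]] by simp
  then show ?thesis using k e unfolding A.exact_pair_iff by blast
qed

text \<open>
  Allowability moves up one step along a \<open>G\<close>-exact sequence, so that it holds throughout a
  \<open>G\<close>-resolution. Writing \<open>f = k \<cdot> e\<close> through the kernel of \<open>g\<close>, both factors split after \<open>U\<close> is
  applied: \<open>U e\<close> because the counit factors through \<open>e\<close>, and \<open>U k\<close> because \<open>g\<close> is allowable.
  Composing the two splittings gives one for \<open>U f\<close>.
\<close>

lemma G_exact_allowable:
  assumes fg: "G_exact A G f g" and g: "allowable A B U g"
  shows "allowable A B U f"
proof -
  have "g \<in> Arr A" using fg by (simp add: G_exact_iff)
  then obtain k where k: "is_kernel A k g" using A.ex_kernel by blast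
  from G_exact_kernel_cover[OF fg k] obtain e h where
    e: "e \<in> homset A (Dom A f) (Dom A k)" "f = k \<cdot>\<^bsub>A\<^esub> e"
    and h: "h \<in> homset A (omap F (omap U (Dom A k))) (Dom A f)" "e \<cdot>\<^bsub>A\<^esub> h = \<epsilon> (Dom A k)" .
  note hk = A.is_kernelD[OF k]
  note Uk = U_homset[OF hk(1)] and Ug = U_homset[OF hk(2)] and Ue = U_homset[OF e(1)]
    and Uh = U_homset[OF h(1)]
  let ?K = "omap U (Dom A k)" and ?Y = "omap U (Dom A g)" and ?Z = "omap U (Cod A g)"
  have Obj: "?Y \<in> Obj B" "?Z \<in> Obj B" "?K \<in> Obj B" using U_Obj A.homsetD[OF hk(2)] hk(3) by auto
  \<comment> \<open>On the epi part: \<open>U e\<close> is split by \<open>\<sigma>\<close>, the adjunct of \<open>h\<close>.\<close>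
  define \<sigma> where "\<sigma> = amap U h \<cdot>\<^bsub>B\<^esub> \<eta> ?K"
  have \<sigma>: "\<sigma> \<in> homset B ?K (omap U (Dom A f))"
    unfolding \<sigma>_def using B.Comp_homset[OF Uh eta_homset[OF Obj(3)]] .
  have e\<sigma>: "amap U e \<cdot>\<^bsub>B\<^esub> \<sigma> = Ident B ?K"
    unfolding \<sigma>_def
    using B.Comp_assoc[OF Ue Uh eta_homset[OF Obj(3)]] U_Comp[OF e(1) h(1)] h(2) triangle_U[OF hk(3)]
    by simp
  \<comment> \<open>On the mono part: \<open>id - s \<cdot> U g\<close> factors through \<open>U k\<close>, the kernel of \<open>U g\<close>.\<close>
  obtain s where s: "s \<in> homset B ?Z ?Y" "amap U g \<cdot>\<^bsub>B\<^esub> s \<cdot>\<^bsub>B\<^esub> amap U g = amap U g"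
    using g by (auto simp: allowable_def)
  note sg = B.Comp_homset[OF s(1) Ug] and id = B.Ident_homset[OF Obj(1)]
  let ?p = "B.diff_arr (Ident B ?Y) (s \<cdot>\<^bsub>B\<^esub> amap U g)"
  have p: "?p \<in> homset B ?Y ?Y" using B.diff_homset[OF id sg] .
  have "amap U g \<cdot>\<^bsub>B\<^esub> ?p = ZeroArr B ?Y ?Z"
    using B.Comp_diff[OF Ug id sg] s(2) B.Comp_Ident[OF Ug] B.diff_eq_Zero_iff[OF Ug Ug] by simp
  then obtain r where r: "r \<in> homset B ?Y ?K" "amap U k \<cdot>\<^bsub>B\<^esub> r = ?p"
    using U_kernel_factor[OF k p] by blast
  have "amap U g \<cdot>\<^bsub>B\<^esub> amap U k = ZeroArr B ?K ?Z"
    using U_Comp[OF hk(2,1)] hk(4) U_Zero[OF hk(3)] A.homsetD(5)[OF hk(2)] by simp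
  then have "(s \<cdot>\<^bsub>B\<^esub> amap U g) \<cdot>\<^bsub>B\<^esub> amap U k = ZeroArr B ?K ?Y"
    using B.Comp_assoc[OF s(1) Ug Uk] B.Comp_Zero[OF s(1) Obj(3)] by simp
  then have pk: "?p \<cdot>\<^bsub>B\<^esub> amap U k = amap U k"
    using B.diff_Comp[OF id sg Uk] B.Ident_Comp[OF Uk] B.eq_diff_iff[OF Uk B.Zero_homset Uk]
      Obj B.AddArr_commute[OF Uk B.Zero_homset] B.Zero_AddArr[OF Uk] by simp
  note \<sigma>r = B.Comp_homset[OF \<sigma> r(1)]
  have Uf: "amap U f = amap U k \<cdot>\<^bsub>B\<^esub> amap U e" using U_Comp[OF hk(1) e(1)] e(2) by simp
  have hUf: "amap U f \<in> homset B (omap U (Dom A f)) ?Y" unfolding Uf using B.Comp_homset[OF Uk Ue] .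
  have "amap U f \<cdot>\<^bsub>B\<^esub> (\<sigma> \<cdot>\<^bsub>B\<^esub> r) = amap U k \<cdot>\<^bsub>B\<^esub> ((amap U e \<cdot>\<^bsub>B\<^esub> \<sigma>) \<cdot>\<^bsub>B\<^esub> r)"
    unfolding Uf using B.Comp_assoc[OF Uk Ue \<sigma>r] B.Comp_assoc[OF Ue \<sigma> r(1)] by simp
  also have "\<dots> = ?p" using e\<sigma> B.Ident_Comp[OF r(1)] r(2) by simp
  finally have "(amap U f \<cdot>\<^bsub>B\<^esub> (\<sigma> \<cdot>\<^bsub>B\<^esub> r)) \<cdot>\<^bsub>B\<^esub> amap U f = (?p \<cdot>\<^bsub>B\<^esub> amap U k) \<cdot>\<^bsub>B\<^esub> amap U e"
    unfolding Uf using B.Comp_assoc[OF p Uk Ue] by simp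
  then have "amap U f \<cdot>\<^bsub>B\<^esub> (\<sigma> \<cdot>\<^bsub>B\<^esub> r) \<cdot>\<^bsub>B\<^esub> amap U f = amap U f"
    using pk B.Comp_assoc[OF hUf \<sigma>r hUf] Uf by simp
  then show ?thesis
    using fg \<sigma>r unfolding allowable_def G_exact_iff by auto
qed

lemma Zero_allowable:
  assumes "X \<in> Obj A" "Y \<in> Obj A"
  shows "allowable A B U (ZeroArr A X Y)"
proof -
  let ?s = "ZeroArr B (omap U Y) (omap U X)" and ?z = "ZeroArr B (omap U X) (omap U Y)"
  have s: "?s \<in> homset B (omap U Y) (omap U X)" and z: "?z \<in> homset B (omap U X) (omap U Y)"
    using B.Zero_homset U_Obj assms by auto
  have "?z \<cdot>\<^bsub>B\<^esub> ?s \<cdot>\<^bsub>B\<^esub> ?z = ?z"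
    using B.Zero_Comp[OF B.Comp_homset[OF s z]] U_Obj assms by simp
  then show ?thesis
    using s U_Zero[OF assms] A.homsetD(1-3)[OF A.Zero_homset[OF assms]] by (auto simp: allowable_def)
qed

text \<open>
  Exactness at \<open>V\<close> is phrased with the arrow from \<open>V\<close> to a zero object. As that arrow is allowable, it
  serves as the start of the induction which shows that every \<open>d n\<close> is.
\<close>

theorem G_resolution_iff_relatively_projective_resolution:
  "G_resolution A G V P d \<longleftrightarrow> relatively_projective_resolution A B U V P d"
proof
  assume "relatively_projective_resolution A B U V P d"
  then show "G_resolution A G V P d"
    using exact_allowable_imp_G_exact
    unfolding relatively_projective_resolution_def G_resolution_def G_projective_iff_relatively_projective
    by blast
next
  assume R: "G_resolution A G V P d"
  then have V: "V \<in> Obj A" by (simp add: G_resolution_def augmented_seq_def)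
  obtain Z where Z: "is_zero_object A Z" "G_exact A G (d 0) (ZeroArr A V Z)"
    using R by (auto simp: G_resolution_def)
  have "allowable A B U (d n)" for n
  proof (induction n)
    case 0
    show ?case using G_exact_allowable[OF Z(2) Zero_allowable[OF V]] Z(1) by (simp add: is_zero_object_def)
  next
    case (Suc n)
    have "G_exact A G (d (Suc n)) (d n)" using R by (simp add: G_resolution_def)
    then show ?case using G_exact_allowable Suc by blast
  qed
  then show "relatively_projective_resolution A B U V P d"
    using R G_exact_imp_exact
    unfolding relatively_projective_resolution_def G_resolution_def G_projective_iff_relatively_projective
    by blast
qed


section \<open>The bar complexes\<close>

lemma G_power_Obj: "V \<in> Obj A \<Longrightarrow> ((omap F \<circ> omap U) ^^ n) V \<in> Obj A"
  using U_Obj F_Obj by (induction n) auto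

lemma G_power_homset:
  "f \<in> homset A X Y \<Longrightarrow>
     ((amap F \<circ> amap U) ^^ n) f \<in> homset A (((omap F \<circ> omap U) ^^ n) X) (((omap F \<circ> omap U) ^^ n) Y)"
  using U_homset F_homset by (induction n) auto

text \<open>
  The two complexes have the same terms and differentials by definition. What could differ is how the
  cochain maps are restricted: once to the hom-sets out of the codomain of a differential, once to those
  out of a term of the complex. That the differentials are arrows between the terms reconciles the two.
\<close>

lemma bar_diff_homset:
  assumes V: "V \<in> Obj A"
  shows "bar_diff A F U \<epsilon> V (Suc n) \<in> homset A (bar_ob F U V (Suc n)) (bar_ob F U V n)"
proof -
  let ?G = "omap F \<circ> omap U"
  let ?H = "homgrp A ((?G ^^ (Suc n + 1)) V) ((?G ^^ Suc n) V)"
  interpret H: comm_group ?H using A.homgrp_comm_group G_power_Obj V by blast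
  have "((amap F \<circ> amap U) ^^ (Suc n - i)) (\<epsilon> ((?G ^^ i) V)) \<in> carrier ?H" if "i \<le> Suc n" for i
  proof -
    have "(?G ^^ (Suc n - i)) ((?G ^^ i) V) = (?G ^^ Suc n) V"
      using that by (metis comp_apply funpow_add le_add_diff_inverse2)
    moreover have "(?G ^^ (Suc n - i)) (omap F (omap U ((?G ^^ i) V))) = (?G ^^ (Suc n + 1)) V"
      using that by (metis Suc_diff_le Suc_eq_plus1 comp_apply funpow.simps(2) funpow_swap1 calculation)
    ultimately show ?thesis
      using G_power_homset[OF eps_homset[OF G_power_Obj[OF V]], of "Suc n - i" i] by (simp del: funpow.simps)
  qed
  then have "bar_diff A F U \<epsilon> V (Suc n) \<in> carrier ?H"
    unfolding bar_diff_def Let_def by (intro H.finprod_closed Pi_I H.int_pow_closed) simp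
  then show ?thesis by (simp add: bar_ob_def del: funpow.simps)
qed

theorem Bar_comonad_eq_Bar_relative:
  assumes "V \<in> Obj A"
  shows "Bar_comonad A G V (Hom_into A W) = Bar_relative A F U \<epsilon> V W"
proof -
  have "G_bar_ob G V = bar_ob F U V" and "G_bar_diff A G V = bar_diff A F U \<epsilon> V"
    by (simp_all add: fun_eq_iff G_bar_ob_def bar_ob_def G_bar_diff_def bar_diff_def)
  then show ?thesis
    using A.homsetD(3)[OF bar_diff_homset[OF assms]]
    by (simp add: Bar_comonad_def Bar_relative_def apply_contra_def hom_cochain_def Hom_into_def)
qed


section \<open>Relative Ext is comonad cohomology\<close>

text \<open>
  Covering a kernel by its counit is the step that builds resolutions: arrows from \<open>G V\<close> which \<open>g\<close>
  kills factor through the kernel and then lift along its counit, an allowable epi.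
\<close>

lemma kernel_counit_G_exact:
  assumes k: "is_kernel A k g"
  shows "G_exact A G (k \<cdot>\<^bsub>A\<^esub> \<epsilon> (Dom A k)) g"
proof -
  note hk = A.is_kernelD[OF k]
  note he = eps_homset[OF hk(3)]
  note hke = A.Comp_homset[OF hk(1) he]
  have "exact_pair A (k \<cdot>\<^bsub>A\<^esub> \<epsilon> (Dom A k)) g"
    unfolding A.exact_pair_iff using k eps_epi[OF hk(3)] he A.homsetD(2)[OF hke] by metis
  moreover have "\<exists>y\<in>homset A (omap F (omap U V)) (omap F (omap U (Dom A k))).
      (k \<cdot>\<^bsub>A\<^esub> \<epsilon> (Dom A k)) \<cdot>\<^bsub>A\<^esub> y = x"
    if V: "V \<in> Obj A" and x: "x \<in> homset A (omap F (omap U V)) (Dom A g)"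
      and gx: "g \<cdot>\<^bsub>A\<^esub> x = ZeroArr A (omap F (omap U V)) (Cod A g)" for V x
  proof -
    obtain u where u: "u \<in> homset A (omap F (omap U V)) (Dom A k)" "k \<cdot>\<^bsub>A\<^esub> u = x"
      using A.kernel_factor[OF k x gx] .
    have "relatively_projective A B U (omap F (omap U V))"
      using G_projective_F[OF U_Obj[OF V]] by (simp add: G_projective_iff_relatively_projective)
    then obtain y where y: "y \<in> homset A (omap F (omap U V)) (omap F (omap U (Dom A k)))"
      "\<epsilon> (Dom A k) \<cdot>\<^bsub>A\<^esub> y = u"
      using u(1) he eps_allowable[OF hk(3)] eps_epi[OF hk(3)]
      unfolding relatively_projective_def by blast
    then show ?thesis using A.Comp_assoc[OF hk(1) he y(1)] u(2) by auto
  qed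
  moreover have "g \<cdot>\<^bsub>A\<^esub> (k \<cdot>\<^bsub>A\<^esub> \<epsilon> (Dom A k)) = ZeroArr A (omap F (omap U (Dom A k))) (Cod A g)"
    using A.Comp_assoc[OF hk(2,1) he] hk(4) A.Zero_Comp[OF he] A.homsetD(5)[OF hk(2)] by simp
  ultimately show ?thesis
    using A.homsetD(2)[OF hke] by (auto simp: G_exact_iff exact_pair_def)
qed

text \<open>
  Rather than checking the acyclicity of the bar complex, resolve by successive kernels:
  \<open>d (n + 1)\<close> is the counit of the kernel of \<open>d n\<close> followed by its inclusion \<open>k (n + 1)\<close>. Starting with
  the identity of \<open>V\<close>, a kernel of the arrow from \<open>V\<close> to a zero object, makes the augmentation an instance
  of the same step.
\<close>

lemma G_resolution_exists:
  assumes V: "V \<in> Obj A"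
  shows "\<exists>P d. G_resolution A G V P d"
proof -
  obtain Z where Z: "is_zero_object A Z" using A.ex_zero_object by blast
  then have ZObj: "Z \<in> Obj A" by (simp add: is_zero_object_def)
  let ?d = "\<lambda>k. k \<cdot>\<^bsub>A\<^esub> \<epsilon> (Dom A k)"
  have d: "?d k \<in> homset A (omap F (omap U (Dom A k))) (Cod A k)" if "k \<in> Arr A" for k
    using A.Comp_homset[OF A.Arr_homset eps_homset] A.Dom_Obj that by blast
  have "\<exists>k. \<forall>n. (k n \<in> Arr A \<and> (n = 0 \<longrightarrow> k n = Ident A V)) \<and> is_kernel A (k (Suc n)) (?d (k n))"
  proof (rule dependent_nat_choice)
    show "\<exists>k. k \<in> Arr A \<and> (0 = (0::nat) \<longrightarrow> k = Ident A V)"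
      using A.homsetD(1)[OF A.Ident_homset[OF V]] by blast
  next
    fix k and n :: nat assume "k \<in> Arr A \<and> (n = 0 \<longrightarrow> k = Ident A V)"
    then obtain k' where "is_kernel A k' (?d k)" using A.ex_kernel A.homsetD(1)[OF d] by blast
    then show "\<exists>k'. (k' \<in> Arr A \<and> (Suc n = 0 \<longrightarrow> k' = Ident A V)) \<and> is_kernel A k' (?d k)"
      by (auto simp: is_kernel_def)
  qed
  then obtain k where k: "\<And>n. k n \<in> Arr A" "k 0 = Ident A V" "\<And>n. is_kernel A (k (Suc n)) (?d (k n))"
    by blast
  have k0: "is_kernel A (k 0) (ZeroArr A V Z)" using A.Ident_is_kernel_of_Zero[OF V ZObj] k(2) by simp
  have Cod: "Cod A (k 0) = V" "Cod A (k (Suc n)) = omap F (omap U (Dom A (k n)))" for n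
    using k(2) A.homsetD(3)[OF A.Ident_homset[OF V]] k(3)[of n] A.homsetD(2)[OF d[OF k(1)]]
    by (auto simp: is_kernel_def)
  have "augmented_seq A V (\<lambda>n. omap F (omap U (Dom A (k n)))) (\<lambda>n. ?d (k n))"
    unfolding augmented_seq_def
    using V d[OF k(1)] Cod F_Obj U_Obj A.Dom_Obj[OF k(1)] by metis
  moreover have "G_projective A G (omap F (omap U (Dom A (k n))))" for n
    using G_projective_F U_Obj A.Dom_Obj k(1) by blast
  ultimately have "G_resolution A G V (\<lambda>n. omap F (omap U (Dom A (k n)))) (\<lambda>n. ?d (k n))"
    using kernel_counit_G_exact[OF k0] kernel_counit_G_exact[OF k(3)] Z by (auto simp: G_resolution_def)
  then show ?thesis by blast
qed

lemma G_resolution_is_complex: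
  assumes R: "G_resolution A G V P d"
  shows "is_complex A V P d"
proof -
  have "d n \<cdot>\<^bsub>A\<^esub> d (Suc n) = ZeroArr A (P (Suc n)) (Cod A (d n))" for n
  proof -
    have "G_exact A G (d (Suc n)) (d n)" "d (Suc n) \<in> homset A (P (Suc n)) (P n)"
      using R by (auto simp: G_resolution_def augmented_seq_def)
    then show ?thesis using A.homsetD(2) by (auto simp: G_exact_iff)
  qed
  then show ?thesis using R by (simp add: is_complex_def G_resolution_def)
qed

text \<open>
  The lifting along the augmentation is \<open>G\<close>-exactness at \<open>V\<close>, where every arrow is a cycle.
\<close>

lemma G_resolution_acyclic_against:
  assumes R: "G_resolution A G V Q e" and P: "G_projective A G P"
  shows "acyclic_against A P V Q e"
proof -
  have aug: "augmented_seq A V Q e" and ex: "G_exact A G (e (Suc n)) (e n)" for n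
    using R by (auto simp: G_resolution_def)
  have dom: "Dom A (e n) = Q n" for n using A.homsetD(2)[OF augmented_seqD(5)[OF aug]] .
  obtain Z where Z: "Z \<in> Obj A" "G_exact A G (e 0) (ZeroArr A V Z)"
    using R by (auto simp: G_resolution_def is_zero_object_def)
  note z = A.Zero_homset[OF augmented_seqD(1)[OF aug] Z(1)]
  have "\<exists>y\<in>homset A P (Q 0). e 0 \<cdot>\<^bsub>A\<^esub> y = x" if "x \<in> homset A P V" for x
    using G_exact_lift[OF Z(2) P] that A.homsetD(2,3)[OF z] A.Zero_Comp[OF that Z(1)] dom by simp
  moreover have "\<exists>y\<in>homset A P (Q (Suc n)). e (Suc n) \<cdot>\<^bsub>A\<^esub> y = x"
    if "x \<in> homset A P (Q n)" "e n \<cdot>\<^bsub>A\<^esub> x = ZeroArr A P (Cod A (e n))" for x n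
    using G_exact_lift[OF ex P, of x n] that dom by simp
  ultimately show ?thesis by (simp add: acyclic_against_def)
qed

lemma apply_contra_Hom_into:
  assumes "augmented_seq A V P d"
  shows "apply_contra (Hom_into A W) P d = hom_cochain A P d W"
  using augmented_seqD(7)[OF assms] by (simp add: apply_contra_def hom_cochain_def Hom_into_def)

text \<open>
  Both groups are computed from \<open>G\<close>-resolutions of the same object, possibly different ones.
\<close>

theorem relative_Ext_iso_comonad_cohomology:
  assumes W: "W \<in> Obj A" and E: "is_relative_Ext A B U n V W E"
    and H: "is_comonad_cohomology A G n V (Hom_into A W) H"
  shows "E \<cong> H"
proof -
  obtain P d where P: "G_resolution A G V P d" and E_eq: "E = cohomology (hom_cochain A P d W) n"
    using E by (auto simp: is_relative_Ext_def G_resolution_iff_relatively_projective_resolution)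
  obtain Q e where Q: "G_resolution A G V Q e"
    and H_eq: "H = cohomology (apply_contra (Hom_into A W) Q e) n"
    using H by (auto simp: is_comonad_cohomology_def)
  have proj: "G_projective A G (P n)" "G_projective A G (Q n)" for n
    using P Q by (auto simp: G_resolution_def)
  have "H = cohomology (hom_cochain A Q e W) n"
    using H_eq apply_contra_Hom_into[of V Q e] Q by (simp add: G_resolution_def)
  then show ?thesis
    unfolding E_eq
    using A.comparison_cohomology_iso[OF G_resolution_is_complex[OF P] G_resolution_is_complex[OF Q] W]
      G_resolution_acyclic_against P Q proj by blast
qed

end


section \<open>Relative and comonad homological algebra coincide\<close>

theorem proposition2p17:
  fixes A :: "('o, 'm) cat" and B :: "('p, 'q) cat"
    and U :: "('o, 'm, 'p, 'q) cat_functor" and F :: "('p, 'q, 'o, 'm) cat_functor"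
    and \<eta> :: "'p \<Rightarrow> 'q" and \<epsilon> :: "'o \<Rightarrow> 'm"
    and G :: "('o, 'm) comonad"
  assumes "abelian_category A" and "abelian_category B"
    and "is_additive_functor A B U" and "is_exact_functor A B U" and "is_faithful_functor A B U"
    and "is_adjunction A B F U \<eta> \<epsilon>"
    and "G = adjunction_comonad F U \<eta> \<epsilon>"
  shows "(\<forall>P\<in>Obj A. G_projective A G P \<longleftrightarrow> relatively_projective A B U P) \<and>
    (\<forall>V P d. augmented_seq A V P d \<longrightarrow>
           (G_resolution A G V P d \<longleftrightarrow> relatively_projective_resolution A B U V P d)) \<and>
    (\<forall>V\<in>Obj A. \<forall>W\<in>Obj A. Bar_comonad A G V (Hom_into A W) = Bar_relative A F U \<epsilon> V W) \<and>
    (\<forall>V\<in>Obj A. \<forall>W\<in>Obj A. \<forall>n.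
           (\<exists>E. is_relative_Ext A B U n V W E) \<and>
           (\<exists>H. is_comonad_cohomology A G n V (Hom_into A W) H) \<and>
           (\<forall>E H. is_relative_Ext A B U n V W E \<longrightarrow>
                  is_comonad_cohomology A G n V (Hom_into A W) H \<longrightarrow> E \<cong> H))"
proof -
  interpret resolvent_pair A B U F \<eta> \<epsilon>
    using assms(1-6) by (simp add: resolvent_pair_def resolvent_pair_axioms_def)
  have "\<exists>E. is_relative_Ext A B U n V W E" "\<exists>H. is_comonad_cohomology A G n V (Hom_into A W) H"
    if "V \<in> Obj A" for V W n
    using G_resolution_exists[OF that] assms(7)
    unfolding is_relative_Ext_def is_comonad_cohomology_def
    by (auto simp: G_resolution_iff_relatively_projective_resolution[symmetric])
  then show ?thesis
    using G_projective_iff_relatively_projective G_resolution_iff_relatively_projective_resolution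
      Bar_comonad_eq_Bar_relative relative_Ext_iso_comonad_cohomology
    unfolding assms(7) by blast
qed

end
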